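(* Let $(m(t),\,t\ge0)$ be a solution of Problem 1. If the initial condition $m_0$ is absolutely continuous with respect to Lebesgue measure, then so is $m(t)$ for every $t\ge0$, and moreover the densities $f(\cdot,t)$ of $m(t)$ satisfy the integro-differential equation $$\frac{\partial f(x,t)}{\partial t}=\frac2w\int_{x-\Delta w}^{x+\Delta w}f\Bigl(\frac{x-(1-w)y}{w},t\Bigr)f(y,t)\,dy-2f(x,t)\int_{x-\Delta}^{x+\Delta}f(y,t)\,dy.\qquad( * )$$ Conversely, if $f:\mathbb{R}\times\mathbb{R}_+\to\mathbb{R}$ is a solution of $( * )$ such that $f(\cdot,t)$ is a probability density function with support $[0,1]$ for every $t\ge0$, then the probability measures $m(t)(dx)=f(x,t)\,dx$ solve Problem 1.
   Context: Fix $\Delta\in(0,1]$ and $w\in(0,1)$. $\mathcal{P}[0,1]$ is the set of Borel probability measures on $[0,1]$; $\langle h,\mu\rangle=\int h\,d\mu$. Problem 1: a family $(m(t),\,t\in\mathbb{R}_+)$ with $m(t)\in\mathcal{P}[0,1]$ is a solution of Problem 1 with initial value $m_0\in\mathcal{P}[0,1]$ if $m(0)=m_0$ and, for all bounded measurable $h:[0,1]\to\mathbb{R}$ and $t\ge0$, $$\langle h,m(t)\rangle-\langle h,m(0)\rangle=\int_0^t 2\iint[h(wx+(1-w)y)-h(x)]\,1_{\{|x-y|\le\Delta\}}\,m(s)(dy)\,m(s)(dx)\,ds.$$ Densities of measures on $[0,1]$ are regarded as functions on $\mathbb{R}$ vanishing outside $[0,1]$; "support $[0,1]$" means vanishing outside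 $[0,1]$. *)

theory Defs imports "HOL-Probability.Probability" begin

abbreviation borel01 :: "real measure" where
  "borel01 \<equiv> restrict_space borel {0..1}"

abbreviation lborel01 :: "real measure" where
  "lborel01 \<equiv> restrict_space lborel {0..1}"

definition prob_measures01 :: "real measure set" where
  "prob_measures01 = {M. prob_space M \<and> sets M = sets borel01}"

definition interaction :: "real \<Rightarrow> real \<Rightarrow> (real \<Rightarrow> real) \<Rightarrow> real measure \<Rightarrow> real" where
  "interaction \<Delta> w h M =
     2 * (LINT x|M. LINT y|M. (h (w * x + (1 - w) * y) - h x) * of_bool (\<bar>x - y\<bar> \<le> \<Delta>))"

text \<open>Integrability of the time integrand is required explicitly, because the Lebesgue integral
  of a non-integrable function is \<open>0\<close> in the library. Values of \<open>m\<close> at negative times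
  are irrelevant.\<close>

definition solves_problem1 ::
  "real \<Rightarrow> real \<Rightarrow> real measure \<Rightarrow> (real \<Rightarrow> real measure) \<Rightarrow> bool" where
  "solves_problem1 \<Delta> w m0 m \<longleftrightarrow>
     (\<forall>t\<ge>0. m t \<in> prob_measures01) \<and> m 0 = m0 \<and>
     (\<forall>h\<in>borel_measurable borel01. bounded (h ` {0..1}) \<longrightarrow>
       (\<forall>t\<ge>0. set_integrable lborel {0..t} (\<lambda>s. interaction \<Delta> w h (m s)) \<and>
         (LINT x|m t. h x) - (LINT x|m 0. h x)
           = (LINT s:{0..t}|lborel. interaction \<Delta> w h (m s))))"

definition prob_density01 :: "(real \<Rightarrow> real) \<Rightarrow> bool" where
  "prob_density01 g \<longleftrightarrow>
     g \<in> borel_measurable borel \<and> (\<forall>x. 0 \<le> g x) \<and> (\<forall>x. x \<notin> {0..1} \<longrightarrow> g x = 0) \<and>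
     integrable lborel g \<and> (LINT x|lborel. g x) = 1"

definition measure01_of :: "(real \<Rightarrow> real) \<Rightarrow> real measure" where
  "measure01_of g = density lborel01 (\<lambda>x. ennreal (g x))"

text \<open>A solution satisfies the equation at all times \<open>t \<ge> 0\<close> (with a one-sided derivative at
  \<open>0\<close>) for every \<open>x\<close> outside a Lebesgue null set that does not depend on \<open>t\<close>; the integrals on
  the right-hand side are required to exist. The null set cannot be dispensed with: if the
  initial density is a multiple of \<open>\<bar>x - 1/2\<bar> powr (-1/2)\<close> near \<open>1/2\<close>, then, whatever versions
  of the densities are chosen, the first integral is infinite at \<open>x = 1/2\<close>.\<close>

definition solves_ide :: "real \<Rightarrow> real \<Rightarrow> (real \<Rightarrow> real \<Rightarrow> real) \<Rightarrow> bool" where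
  "solves_ide \<Delta> w f \<longleftrightarrow>
     (AE x in lborel. \<forall>t\<ge>0.
        set_integrable lborel {x - \<Delta> * w .. x + \<Delta> * w}
          (\<lambda>y. f ((x - (1 - w) * y) / w) t * f y t) \<and>
        set_integrable lborel {x - \<Delta> .. x + \<Delta>} (\<lambda>y. f y t) \<and>
        ((\<lambda>s. f x s) has_real_derivative
           (2 / w * (LINT y:{x - \<Delta> * w .. x + \<Delta> * w}|lborel.
                       f ((x - (1 - w) * y) / w) t * f y t)
            - 2 * f x t * (LINT y:{x - \<Delta> .. x + \<Delta>}|lborel. f y t)))
          (at t within {0..}))"

end

theory Submission imports Defs begin

text \<open>The three pillars of the proof are that every solution of the integro-differential equation solves
Problem 1, that Problem 1 has at most one solution for each initial value, and that the
integro-differential equation has a solution for every initial density. The converse half of the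
theorem is the first pillar. The forward half follows from all three: given a solution \<open>m\<close> of
Problem 1 whose initial value has a density \<open>g\<close>, take a solution \<open>f\<close> of the equation that starts
at \<open>g\<close>; the measures with densities \<open>f(\<cdot>, t)\<close> solve Problem 1 with the same initial value, so they
are the measures \<open>m(t)\<close>. In this way \<open>m\<close> inherits the absolute continuity, and its
densities the regularity in time, from a solution that is constructed explicitly.

\<^emph>\<open>From the equation to Problem 1\<close> (\<open>ide_solution_solves_problem1\<close>). The substitution
\<open>x \<mapsto> w x + (1 - w) y\<close> turns the integral of a test function against the right-hand side of the
equation into the interaction term of Problem 1. It remains to integrate the equation in time and
to exchange the integrals over space and time. The measurability that this requires comes from
the fact that \<open>f\<close> is measurable in \<open>x\<close> and continuous in \<open>t\<close>.

\<^emph>\<open>Uniqueness\<close> (\<open>problem1_unique\<close>). The interaction term is quadratic in the measure, hence Lipschitz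
in total variation on probability measures. The Picard argument then gives the bound
\<open>2 (8 t)^n / n!\<close>, for every \<open>n\<close>, on the distance of two solutions at time \<open>t\<close>.

\<^emph>\<open>Existence\<close> (\<open>ide_solution_exists\<close>). For a probability density \<open>f\<close> the loss factor
\<open>\<integral> f\<close> over the points near \<open>x\<close> is 1 minus the integral over the distant points, so that the equation
reads \<open>f' = 2 B(f, f) - 2 f\<close> with a bilinear operator \<open>B\<close> that preserves positivity and multiplies
masses. Its solution is the Wild sum
\<open>f(x, t) = p \<Sum>\<^sub>n (1 - p)^n u\<^sub>n(x)\<close> with \<open>p = exp (- 2 t)\<close>, where \<open>u\<^sub>0\<close> is the initial density and
\<open>(n + 1) u\<^sub>n\<^sub>+\<^sub>1 = \<Sum>\<^sub>k\<^sub>\<le>\<^sub>n B(u\<^sub>k, u\<^sub>n\<^sub>-\<^sub>k)\<close>. All \<open>u\<^sub>n\<close> are probability densities, so for almost every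
\<open>x\<close> the power series \<open>\<Sum>\<^sub>n \<tau>^n u\<^sub>n(x)\<close> converges for all \<open>0 \<le> \<tau> < 1\<close>. At such an \<open>x\<close> termwise
differentiation yields the equation at all times simultaneously. This is what makes the exceptional
null set independent of \<open>t\<close>.\<close>

section \<open>Probability measures and densities on the unit interval\<close>

lemma convex_combination_in_unit_interval:
  fixes x y w :: real
  assumes "x \<in> {0..1}" "y \<in> {0..1}" "0 < w" "w < 1"
  shows "w * x + (1 - w) * y \<in> {0..1}"
proof -
  have "w * x + (1 - w) * y \<le> 1"
    using assms by (intro convex_bound_le) auto
  then show ?thesis using assms by simp
qed

lemma prob_measures01_simps:
  assumes "M \<in> prob_measures01"
  shows "prob_space M" "sets M = sets borel01" "space M = {0..1}"
proof -
  show "prob_space M" "sets M = sets borel01"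
    using assms by (auto simp: prob_measures01_def)
  then show "space M = {0..1}"
    by (auto dest: sets_eq_imp_space_eq simp: space_restrict_space)
qed

lemma bounded_integrable_prob01:
  fixes h :: "real \<Rightarrow> real"
  assumes "M \<in> prob_measures01" "h \<in> borel_measurable borel01" "\<And>x. x \<in> {0..1} \<Longrightarrow> \<bar>h x\<bar> \<le> C"
  shows "integrable M h"
proof -
  interpret prob_space M using prob_measures01_simps[OF assms(1)] by simp
  have "h \<in> borel_measurable M"
    using assms(2) by (simp cong: measurable_cong_sets add: prob_measures01_simps[OF assms(1)])
  then show ?thesis
    by (intro integrable_const_bound[of _ C]) 
       (use assms in \<open>auto simp: prob_measures01_simps[OF assms(1)]\<close>)
qed

lemma abs_integral_le_prob01:
  fixes h :: "real \<Rightarrow> real"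
  assumes "M \<in> prob_measures01" "h \<in> borel_measurable borel01" "\<And>x. x \<in> {0..1} \<Longrightarrow> \<bar>h x\<bar> \<le> C"
  shows "\<bar>LINT x|M. h x\<bar> \<le> C"
proof -
  interpret prob_space M using prob_measures01_simps[OF assms(1)] by simp
  have I: "integrable M h" using bounded_integrable_prob01[OF assms] .
  have "\<bar>LINT x|M. h x\<bar> \<le> (LINT x|M. \<bar>h x\<bar>)" by (rule integral_abs_bound)
  also have "\<dots> \<le> (LINT x|M. C)"
    using I assms(3) by (intro integral_mono) (auto simp: prob_measures01_simps[OF assms(1)])
  finally show ?thesis by (simp add: prob_space)
qed

lemma prob_density01_simps:
  assumes "prob_density01 g"
  shows "g \<in> borel_measurable borel" "0 \<le> g x" "x \<notin> {0..1} \<Longrightarrow> g x = 0" "integrable lborel g"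
    "(LINT x|lborel. g x) = 1" "(\<integral>\<^sup>+x. ennreal (g x) \<partial>lborel) = 1"
proof -
  show "g \<in> borel_measurable borel" "0 \<le> g x" "x \<notin> {0..1} \<Longrightarrow> g x = 0"
    and *: "integrable lborel g" "(LINT x|lborel. g x) = 1"
    using assms by (auto simp: prob_density01_def)
  show "(\<integral>\<^sup>+x. ennreal (g x) \<partial>lborel) = 1"
    using nn_integral_eq_integral[OF *(1)] assms * by (simp add: prob_density01_def)
qed

lemma prob_density01I:
  assumes "g \<in> borel_measurable borel" "\<And>x. 0 \<le> g x" "\<And>x. x \<notin> {0..1} \<Longrightarrow> g x = 0"
    "(\<integral>\<^sup>+x. ennreal (g x) \<partial>lborel) = 1"
  shows "prob_density01 g"
proof -
  have "has_bochner_integral lborel g 1"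
    using assms by (intro has_bochner_integral_nn_integral) auto
  then show ?thesis
    using assms by (auto simp: prob_density01_def has_bochner_integral_iff)
qed

lemma set_integrable_prob_density01:
  assumes "prob_density01 g" "A \<in> sets borel"
  shows "set_integrable lborel A g"
  unfolding set_integrable_def
  using assms(2) by (intro integrable_mult_indicator prob_density01_simps(4)[OF assms(1)]) simp

lemma LINT_measure01_of:
  fixes \<phi> :: "real \<Rightarrow> real"
  assumes g: "prob_density01 g" and \<phi>: "\<phi> \<in> borel_measurable borel"
  shows "(LINT x|measure01_of g. \<phi> x) = (LINT x|lborel. g x * \<phi> x)"
proof -
  have "(LINT x|measure01_of g. \<phi> x) = (LINT x|lborel01. g x *\<^sub>R \<phi> x)"
    unfolding measure01_of_def using prob_density01_simps(1,2)[OF g] \<phi>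
    by (intro integral_density measurable_restrict_space1) auto
  also have "\<dots> = (LINT x|lborel. indicator {0..1} x *\<^sub>R (g x *\<^sub>R \<phi> x))"
    by (rule integral_restrict_space) simp
  also have "\<dots> = (LINT x|lborel. g x * \<phi> x)"
    using prob_density01_simps(3)[OF g] by (intro Bochner_Integration.integral_cong) (auto simp: indicator_def)
  finally show ?thesis .
qed

lemma space_measure01_of: "space (measure01_of g) = {0..1}"
  by (simp add: measure01_of_def space_restrict_space)

lemma sets_measure01_of: "sets (measure01_of g) = sets borel01"
  by (simp add: measure01_of_def sets_restrict_space)

lemma measure01_of_prob_measures01:
  assumes g: "prob_density01 g"
  shows "measure01_of g \<in> prob_measures01"
proof -
  have "emeasure (measure01_of g) (space (measure01_of g)) = (\<integral>\<^sup>+x. ennreal (g x) * indicator {0..1} x \<partial>lborel01)"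
    unfolding space_measure01_of unfolding measure01_of_def using prob_density01_simps(1)[OF g]
    by (subst emeasure_density) (auto simp: sets_restrict_space intro!: measurable_restrict_space1)
  also have "\<dots> = (\<integral>\<^sup>+x. ennreal (g x) * indicator {0..1} x * indicator {0..1} x \<partial>lborel)"
    by (rule nn_integral_restrict_space) simp
  also have "\<dots> = (\<integral>\<^sup>+x. ennreal (g x) \<partial>lborel)"
    using prob_density01_simps(3)[OF g] by (intro nn_integral_cong) (auto simp: indicator_def)
  finally show ?thesis
    using prob_density01_simps(6)[OF g] by (auto simp: prob_measures01_def sets_measure01_of intro: prob_spaceI)
qed

lemma measure01_of_cong_AE:
  assumes "f \<in> borel_measurable borel" "g \<in> borel_measurable borel" "AE x in lborel. f x = g x"
  shows "measure01_of f = measure01_of g"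
  unfolding measure01_of_def using assms
  by (intro density_cong measurable_restrict_space1) (auto simp: AE_restrict_space_iff elim: eventually_mono)

lemma density_of_absolutely_continuous:
  assumes M: "M \<in> prob_measures01" and ac: "absolutely_continuous lborel01 M"
  obtains g where "prob_density01 g" "M = measure01_of g"
proof -
  interpret prob_space M using prob_measures01_simps[OF M] by simp
  have fin: "finite_measure lborel01"
    by (intro finite_measureI) (simp add: emeasure_restrict_space space_restrict_space)
  interpret L: finite_measure lborel01 by (rule fin)
  have sets: "sets M = sets lborel01"
    using prob_measures01_simps[OF M] by (simp add: sets_restrict_space)
  obtain D where D: "D \<in> borel_measurable lborel01" "AE x in lborel01. RN_deriv lborel01 M x = ennreal (D x)"
    "\<And>x. 0 \<le> D x"
    using L.real_RN_deriv[OF finite_measure_axioms ac sets] by metis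
  define g where "g = (\<lambda>x. indicator {0..1} x * D x)"
  have g_meas [measurable]: "g \<in> borel_measurable borel"
    using D(1) by (simp add: g_def borel_measurable_restrict_space_iff)
  have "M = density lborel01 (RN_deriv lborel01 M)"
    using L.density_RN_deriv[OF ac sets] by simp
  also have "\<dots> = measure01_of g"
    unfolding measure01_of_def
  proof (rule density_cong)
    show "(\<lambda>x. ennreal (g x)) \<in> borel_measurable lborel01"
      by (intro measurable_restrict_space1) simp
    show "AE x in lborel01. RN_deriv lborel01 M x = ennreal (g x)"
      using D(2) by (auto simp: AE_restrict_space_iff g_def elim!: eventually_mono)
  qed simp
  finally have M_eq: "M = measure01_of g" .
  have "1 = emeasure M {0..1}"
    using emeasure_space_1 prob_measures01_simps[OF M] by simp
  also have "\<dots> = (\<integral>\<^sup>+x. ennreal (g x) * indicator {0..1} x \<partial>lborel01)"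
    unfolding M_eq measure01_of_def
    by (subst emeasure_density) (auto simp: sets_restrict_space intro!: measurable_restrict_space1)
  also have "\<dots> = (\<integral>\<^sup>+x. ennreal (g x) * indicator {0..1} x * indicator {0..1} x \<partial>lborel)"
    by (rule nn_integral_restrict_space) simp
  also have "\<dots> = (\<integral>\<^sup>+x. ennreal (g x) \<partial>lborel)"
    by (intro nn_integral_cong) (auto simp: g_def indicator_def)
  finally have "prob_density01 g"
    using g_meas D(3) by (intro prob_density01I) (simp_all add: g_def)
  then show thesis using M_eq that by blast
qed

lemma absolutely_continuous_measure01_of:
  assumes "g \<in> borel_measurable borel"
  shows "absolutely_continuous lborel01 (measure01_of g)"
  unfolding measure01_of_def using assms
  by (intro absolutely_continuousI_density measurable_compose[OF _ measurable_ennreal] measurable_restrict_space1) auto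

section \<open>Uniqueness for Problem 1\<close>

definition collision_kernel :: "real \<Rightarrow> real \<Rightarrow> (real \<Rightarrow> real) \<Rightarrow> real \<Rightarrow> real \<Rightarrow> real" where
  "collision_kernel \<Delta> w h x y = (h (w * x + (1 - w) * y) - h x) * of_bool (\<bar>x - y\<bar> \<le> \<Delta>)"

lemma measurable_collision_kernel:
  assumes "0 < w" "w < 1" "h \<in> borel_measurable borel01"
  shows "(\<lambda>(x, y). collision_kernel \<Delta> w h x y) \<in> borel_measurable (borel01 \<Otimes>\<^sub>M borel01)"
proof -
  have id: "(\<lambda>x. x) \<in> borel_measurable borel01"
    by (intro measurable_restrict_space1) simp
  have f: "fst \<in> borel_measurable (borel01 \<Otimes>\<^sub>M borel01)"
    using measurable_comp[OF measurable_fst id] by (simp add: comp_def)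
  have s: "snd \<in> borel_measurable (borel01 \<Otimes>\<^sub>M borel01)"
    using measurable_comp[OF measurable_snd id] by (simp add: comp_def)
  have c: "(\<lambda>z. w * fst z + (1 - w) * snd z) \<in> measurable (borel01 \<Otimes>\<^sub>M borel01) borel01"
    using f s convex_combination_in_unit_interval[OF _ _ assms(1,2)]
    by (intro measurable_restrict_space2)
       (auto simp: space_pair_measure space_restrict_space simp del: atLeastAtMost_iff)
  have "(\<lambda>z. (h (w * fst z + (1 - w) * snd z) - h (fst z)) * of_bool (\<bar>fst z - snd z\<bar> \<le> \<Delta>))
      \<in> borel_measurable (borel01 \<Otimes>\<^sub>M borel01)"
    using f s measurable_compose[OF c assms(3)] measurable_compose[OF measurable_fst assms(3)]
    by (intro borel_measurable_times borel_measurable_diff) auto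
  then show ?thesis by (simp add: collision_kernel_def case_prod_unfold)
qed

lemma abs_collision_kernel_le:
  assumes "0 < w" "w < 1" "x \<in> {0..1}" "y \<in> {0..1}" "\<And>x. x \<in> {0..1} \<Longrightarrow> \<bar>h x\<bar> \<le> 1"
  shows "\<bar>collision_kernel \<Delta> w h x y\<bar> \<le> 2"
  using assms(5)[OF assms(3)] assms(5)[OF convex_combination_in_unit_interval[OF assms(3,4,1,2)]]
  by (auto simp: collision_kernel_def)

text \<open>The supremum of \<open>\<bar>\<langle>k, M\<rangle> - \<langle>k, M'\<rangle>\<bar>\<close> over \<open>\<bar>k\<bar> \<le> 1\<close> is the total variation norm of \<open>M - M'\<close>. The
constant 8 is the factor 2 in front of the integral, times the bound 2 on the kernel, times the two
occurrences of the measure.\<close>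
lemma interaction_lipschitz:
  fixes h :: "real \<Rightarrow> real"
  assumes w: "0 < w" "w < 1" and M: "M \<in> prob_measures01" and M': "M' \<in> prob_measures01"
    and close: "\<And>k. k \<in> borel_measurable borel01 \<Longrightarrow> (\<And>x. x \<in> {0..1} \<Longrightarrow> \<bar>k x\<bar> \<le> 1) \<Longrightarrow>
      \<bar>(LINT x|M. k x) - (LINT x|M'. k x)\<bar> \<le> \<epsilon>"
    and h: "h \<in> borel_measurable borel01" "\<And>x. x \<in> {0..1} \<Longrightarrow> \<bar>h x\<bar> \<le> 1"
  shows "\<bar>interaction \<Delta> w h M - interaction \<Delta> w h M'\<bar> \<le> 8 * \<epsilon>"
proof -
  define K where "K = collision_kernel \<Delta> w h"
  have close2: "\<bar>(LINT x|M. k x) - (LINT x|M'. k x)\<bar> \<le> 2 * \<epsilon>"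
    if k: "k \<in> borel_measurable borel01" "\<And>x. x \<in> {0..1} \<Longrightarrow> \<bar>k x\<bar> \<le> 2" for k
    using close[of "\<lambda>x. k x / 2"] k by simp
  have K_meas: "(\<lambda>(x, y). K x y) \<in> borel_measurable (borel01 \<Otimes>\<^sub>M borel01)"
    unfolding K_def using measurable_collision_kernel[OF w h(1)] .
  have K_y: "K x \<in> borel_measurable borel01" if "x \<in> {0..1}" for x
    using measurable_compose_Pair1[OF _ K_meas, of x] that by (simp add: space_restrict_space)
  have K_le: "\<bar>K x y\<bar> \<le> 2" if "x \<in> {0..1}" "y \<in> {0..1}" for x y
    unfolding K_def using abs_collision_kernel_le[OF w that h(2)] .
  have inner: "(\<lambda>x. LINT y|N. K x y) \<in> borel_measurable borel01"
    "\<And>x. x \<in> {0..1} \<Longrightarrow> \<bar>LINT y|N. K x y\<bar> \<le> 2" if N: "N \<in> prob_measures01" for N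
  proof -
    interpret prob_space N using prob_measures01_simps[OF N] by simp
    have "(\<lambda>(x, y). K x y) \<in> borel_measurable (borel01 \<Otimes>\<^sub>M N)"
      using K_meas prob_measures01_simps(2)[OF N] by (simp cong: measurable_cong_sets sets_pair_measure_cong)
    then show "(\<lambda>x. LINT y|N. K x y) \<in> borel_measurable borel01"
      by (rule borel_measurable_lebesgue_integral)
    show "\<bar>LINT y|N. K x y\<bar> \<le> 2" if "x \<in> {0..1}" for x
      using abs_integral_le_prob01[OF N K_y[OF that]] K_le[OF that] by blast
  qed
  \<comment> \<open>Exchange \<open>M\<close> for \<open>M'\<close> first in the inner and then in the outer integral; each exchange costs
    at most \<open>2 * \<epsilon>\<close> because \<open>K\<close> and its partial integrals are bounded by 2.\<close>
  have "\<bar>(LINT x|M. (LINT y|M. K x y) - (LINT y|M'. K x y))\<bar> \<le> 2 * \<epsilon>"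
    using inner[OF M] inner[OF M'] close2 K_y K_le
    by (intro abs_integral_le_prob01[OF M]) auto
  moreover have "(LINT x|M. (LINT y|M. K x y) - (LINT y|M'. K x y)) =
      (LINT x|M. LINT y|M. K x y) - (LINT x|M. LINT y|M'. K x y)"
    using bounded_integrable_prob01[OF M] inner[OF M] inner[OF M']
    by (intro Bochner_Integration.integral_diff) blast+
  moreover have "\<bar>(LINT x|M. LINT y|M'. K x y) - (LINT x|M'. LINT y|M'. K x y)\<bar> \<le> 2 * \<epsilon>"
    using inner[OF M'] close2 by blast
  ultimately have "\<bar>(LINT x|M. LINT y|M. K x y) - (LINT x|M'. LINT y|M'. K x y)\<bar> \<le> 4 * \<epsilon>"
    by linarith
  then show ?thesis by (simp add: interaction_def K_def collision_kernel_def)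
qed

lemma set_integral_power_from_0:
  fixes t :: real
  assumes "0 \<le> t"
  shows "set_integrable lborel {0..t} (\<lambda>s. s ^ n)" "(LINT s:{0..t}|lborel. s ^ n) = t ^ Suc n / Suc n"
proof -
  show "set_integrable lborel {0..t} (\<lambda>s. s ^ n)"
    by (rule borel_integrable_atLeastAtMost') (intro continuous_intros)
  show "(LINT s:{0..t}|lborel. s ^ n) = t ^ Suc n / Suc n"
    using integral_power[OF assms, of n]
    by (simp add: set_lebesgue_integral_def mult.commute indicator_def if_distrib cong: if_cong)
qed

text \<open>The Picard iteration: inserting a bound on the distance of the two solutions into their integral
equations and using the Lipschitz property improves the bound by one power of \<open>t\<close>. Since the bound is
for all test functions simultaneously, the induction hypothesis applies to the partial integrals of
the kernel as well.\<close>
lemma solutions_contract: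
  assumes w: "0 < w" "w < 1" and m: "solves_problem1 \<Delta> w m0 m" and m': "solves_problem1 \<Delta> w m0 m'"
    and "0 \<le> t" and "h \<in> borel_measurable borel01" "\<And>x. x \<in> {0..1} \<Longrightarrow> \<bar>h x\<bar> \<le> 1"
  shows "\<bar>(LINT x|m t. h x) - (LINT x|m' t. h x)\<bar> \<le> 2 * (8 * t) ^ n / fact n"
  using assms(5-)
proof (induction n arbitrary: t h)
  case 0
  have "m t \<in> prob_measures01" "m' t \<in> prob_measures01"
    using m m' 0 by (auto simp: solves_problem1_def)
  then have "\<bar>LINT x|m t. h x\<bar> \<le> 1" "\<bar>LINT x|m' t. h x\<bar> \<le> 1"
    using abs_integral_le_prob01 0 by blast+
  then show ?case by simp
next
  case (Suc n)
  let ?I = "\<lambda>s. interaction \<Delta> w h (m s)" and ?I' = "\<lambda>s. interaction \<Delta> w h (m' s)"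
  have b: "bounded (h ` {0..1})"
    using Suc.prems(3) by (auto simp: bounded_iff intro!: exI[of _ 1])
  have int: "set_integrable lborel {0..t} ?I" "set_integrable lborel {0..t} ?I'"
    using m m' b Suc.prems by (auto simp: solves_problem1_def)
  have "(LINT x|m t. h x) - (LINT x|m' t. h x) =
      (LINT s:{0..t}|lborel. ?I s) - (LINT s:{0..t}|lborel. ?I' s)"
    using m m' b Suc.prems by (fastforce simp: solves_problem1_def)
  also have "\<dots> = (LINT s:{0..t}|lborel. ?I s - ?I' s)"
    using int by (simp add: set_integral_diff)
  finally have "\<bar>(LINT x|m t. h x) - (LINT x|m' t. h x)\<bar> \<le> (LINT s:{0..t}|lborel. \<bar>?I s - ?I' s\<bar>)"
    unfolding set_lebesgue_integral_def
    using integral_abs_bound[of lborel "\<lambda>s. indicator {0..t} s *\<^sub>R (?I s - ?I' s)"]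
    by (simp add: abs_mult)
  also have "\<dots> \<le> (LINT s:{0..t}|lborel. 16 * 8 ^ n / fact n * s ^ n)"
  proof (rule set_integral_mono)
    show "set_integrable lborel {0..t} (\<lambda>s. \<bar>?I s - ?I' s\<bar>)"
      using int by (intro set_integrable_abs set_integral_diff)
    show "set_integrable lborel {0..t} (\<lambda>s. 16 * 8 ^ n / fact n * s ^ n)"
      using set_integral_power_from_0(1)[OF Suc.prems(1)] by (intro set_integrable_mult_right) auto
    show "\<bar>?I s - ?I' s\<bar> \<le> 16 * 8 ^ n / fact n * s ^ n" if "s \<in> {0..t}" for s
    proof -
      have "\<bar>?I s - ?I' s\<bar> \<le> 8 * (2 * (8 * s) ^ n / fact n)"
        using that m m' Suc.prems Suc.IH
        by (intro interaction_lipschitz[OF w]) (auto simp: solves_problem1_def)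
      then show ?thesis by (simp add: power_mult_distrib)
    qed
  qed
  also have "\<dots> = 16 * 8 ^ n / fact n * (t ^ Suc n / Suc n)"
    using set_integral_power_from_0[OF Suc.prems(1)] by simp
  also have "\<dots> = 2 * (8 * t) ^ Suc n / fact (Suc n)"
    by (simp add: power_mult_distrib mult_ac)
  finally show ?case .
qed

theorem problem1_unique:
  assumes w: "0 < w" "w < 1" and m: "solves_problem1 \<Delta> w m0 m" and m': "solves_problem1 \<Delta> w m0 m'"
    and t: "0 \<le> t"
  shows "m t = m' t"
proof -
  have P: "m t \<in> prob_measures01" "m' t \<in> prob_measures01"
    using m m' t by (auto simp: solves_problem1_def)
  interpret a: prob_space "m t" using prob_measures01_simps[OF P(1)] by simp
  interpret b: prob_space "m' t" using prob_measures01_simps[OF P(2)] by simp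
  have "measure (m t) A = measure (m' t) A" if A: "A \<in> sets (m t)" for A
  proof -
    have A': "A \<in> sets borel01" "A \<in> sets (m' t)"
      using A by (auto simp: prob_measures01_simps[OF P(1)] prob_measures01_simps[OF P(2)])
    have ind: "(indicat_real A) \<in> borel_measurable borel01" using A' by simp
    have abs_ind: "\<bar>indicat_real A x\<bar> \<le> 1" for x
      by (simp add: indicator_def)
    have le: "\<bar>measure (m t) A - measure (m' t) A\<bar> \<le> 2 * (8 * t) ^ n / fact n" for n
      using solutions_contract[OF w m m' t ind abs_ind, of n] A A' by simp
    have "(\<lambda>n. (8 * t) ^ n / fact n) \<longlonglongrightarrow> 0"
      using summable_LIMSEQ_zero[OF summable_exp[of "8 * t"]] by (simp add: field_simps)
    then have "(\<lambda>n. 2 * ((8 * t) ^ n / fact n)) \<longlonglongrightarrow> 2 * 0"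
      by (intro tendsto_intros)
    then have "\<bar>measure (m t) A - measure (m' t) A\<bar> \<le> 0"
      by (intro LIMSEQ_le_const[of "\<lambda>n. 2 * ((8 * t) ^ n / fact n)"]) (use le in auto)
    then show ?thesis by simp
  qed
  then show ?thesis
    by (intro measure_eqI)
       (auto simp: prob_measures01_simps[OF P(1)] prob_measures01_simps[OF P(2)]
         a.emeasure_eq_measure b.emeasure_eq_measure)
qed

section \<open>The change of variables of an interaction\<close>

lemma collision_distance_iff:
  fixes w :: real
  assumes "0 < w"
  shows "\<bar>(1 - w) * y + w * x - y\<bar> \<le> \<Delta> * w \<longleftrightarrow> \<bar>x - y\<bar> \<le> \<Delta>"
proof -
  have "(1 - w) * y + w * x - y = w * (x - y)" by (simp add: algebra_simps)
  then show ?thesis using assms by (simp add: abs_mult mult.commute)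
qed

lemma AE_lborel_affine:
  fixes P :: "real \<Rightarrow> bool"
  assumes "AE x in lborel. P x" "c \<noteq> 0"
  shows "AE x in lborel. P (t + c * x)"
proof -
  obtain N where N: "N \<in> null_sets lborel" "{x. \<not> P x} \<subseteq> N"
    using assms(1) by (auto simp: eventually_ae_filter)
  then have [measurable]: "N \<in> sets borel" by auto
  have "AE x in lborel. x \<notin> N"
    using N(1) by (rule AE_not_in)
  then have "AE x in lborel. t + c * x \<notin> N"
    by (intro AE_borel_affine assms(2)) auto
  then show ?thesis
    by eventually_elim (use N(2) in auto)
qed

text \<open>The gain integral at a single \<open>x\<close> evaluates the density along the line \<open>y \<mapsto> (x - (1 - w) y) / w\<close>.
This lemma shows that it nevertheless depends on the density only up to null sets.\<close>
lemma AE_collision_partner: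
  fixes P :: "real \<Rightarrow> bool"
  assumes "AE x in lborel. P x" "0 < w" "w < 1"
  shows "AE y in lborel. P ((x - (1 - w) * y) / w)"
proof -
  have "x / w + - (1 - w) / w * y = (x - (1 - w) * y) / w" for y
    using assms(2) by (simp add: field_simps)
  then show ?thesis
    using AE_lborel_affine[OF assms(1), of "- (1 - w) / w" "x / w"] assms(2,3) by simp
qed

text \<open>A pair at \<open>(x, y)\<close> moves its first member to \<open>w x + (1 - w) y\<close>. On the left the pair is described by
this new position and \<open>y\<close>, on the right by the old positions; the factor \<open>w\<close> is the Jacobian. The new
position lies within \<open>\<Delta> w\<close> of \<open>y\<close> if and only if the old one lies within \<open>\<Delta>\<close> of \<open>y\<close>.\<close>
lemma nn_integral_collision_change:
  fixes h k v :: "real \<Rightarrow> ennreal"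
  assumes "0 < w" and [measurable]: "h \<in> borel_measurable borel" "k \<in> borel_measurable borel" "v \<in> borel_measurable borel"
  shows "(\<integral>\<^sup>+x. h x * (\<integral>\<^sup>+y. k ((x - (1 - w) * y) / w) * v y * indicator {x - \<Delta> * w .. x + \<Delta> * w} y \<partial>lborel) \<partial>lborel) =
    ennreal w * (\<integral>\<^sup>+x. \<integral>\<^sup>+y. h (w * x + (1 - w) * y) * (k x * v y) * indicator {x - \<Delta> .. x + \<Delta>} y \<partial>lborel \<partial>lborel)"
proof -
  let ?c = "\<lambda>x y. h x * (k ((x - (1 - w) * y) / w) * v y * indicator {z. \<bar>fst z - snd z\<bar> \<le> \<Delta> * w} (x, y))"
  note iff = collision_distance_iff[OF \<open>0 < w\<close>]
  have "(\<integral>\<^sup>+x. h x * (\<integral>\<^sup>+y. k ((x - (1 - w) * y) / w) * v y * indicator {x - \<Delta> * w .. x + \<Delta> * w} y \<partial>lborel) \<partial>lborel)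
      = (\<integral>\<^sup>+x. \<integral>\<^sup>+y. ?c x y \<partial>lborel \<partial>lborel)"
    by (subst nn_integral_cmult[symmetric]) (auto intro!: nn_integral_cong simp: indicator_def abs_le_iff)
  also have "\<dots> = (\<integral>\<^sup>+y. \<integral>\<^sup>+x. ?c x y \<partial>lborel \<partial>lborel)"
    by (rule lborel_pair.Fubini') simp
  \<comment> \<open>With \<open>y\<close> fixed, pass from the position \<open>x\<close> after the interaction to the position before it.\<close>
  also have "\<dots> = (\<integral>\<^sup>+y. ennreal w * (\<integral>\<^sup>+x. ?c ((1 - w) * y + w * x) y \<partial>lborel) \<partial>lborel)"
  proof (rule nn_integral_cong)
    fix y :: real
    show "(\<integral>\<^sup>+x. ?c x y \<partial>lborel) = ennreal w * (\<integral>\<^sup>+x. ?c ((1 - w) * y + w * x) y \<partial>lborel)"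
      using \<open>0 < w\<close> by (subst nn_integral_real_affine[of _ w "(1 - w) * y"]) auto
  qed
  also have "\<dots> = (\<integral>\<^sup>+y. ennreal w * (\<integral>\<^sup>+x. h (w * x + (1 - w) * y) * (k x * v y) * indicator {z. \<bar>fst z - snd z\<bar> \<le> \<Delta>} (x, y) \<partial>lborel) \<partial>lborel)"
    using iff \<open>0 < w\<close> by (auto intro!: nn_integral_cong arg_cong2[where f="(*)"] simp: indicator_def ac_simps)
  also have "\<dots> = ennreal w * (\<integral>\<^sup>+y. \<integral>\<^sup>+x. h (w * x + (1 - w) * y) * (k x * v y) * indicator {z. \<bar>fst z - snd z\<bar> \<le> \<Delta>} (x, y) \<partial>lborel \<partial>lborel)"
    by (rule nn_integral_cmult) simp
  also have "\<dots> = ennreal w * (\<integral>\<^sup>+x. \<integral>\<^sup>+y. h (w * x + (1 - w) * y) * (k x * v y) * indicator {z. \<bar>fst z - snd z\<bar> \<le> \<Delta>} (x, y) \<partial>lborel \<partial>lborel)"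
    by (subst lborel_pair.Fubini') simp_all
  finally show ?thesis
    by (auto intro!: nn_integral_cong arg_cong2[where f="(*)"] simp: indicator_def abs_le_iff)
qed

section \<open>The right-hand side of the equation\<close>

definition gain_integral :: "real \<Rightarrow> real \<Rightarrow> (real \<Rightarrow> real) \<Rightarrow> real \<Rightarrow> real" where
  "gain_integral \<Delta> w g x = (LINT y:{x - \<Delta> * w .. x + \<Delta> * w}|lborel. g ((x - (1 - w) * y) / w) * g y)"

definition near_mass :: "real \<Rightarrow> (real \<Rightarrow> real) \<Rightarrow> real \<Rightarrow> real" where
  "near_mass \<Delta> g x = (LINT y:{x - \<Delta> .. x + \<Delta>}|lborel. g y)"

definition ide_rhs :: "real \<Rightarrow> real \<Rightarrow> (real \<Rightarrow> real) \<Rightarrow> real \<Rightarrow> real" where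
  "ide_rhs \<Delta> w g x = 2 / w * gain_integral \<Delta> w g x - 2 * g x * near_mass \<Delta> g x"

lemma ide_rhs_cong_AE:
  assumes w: "0 < w" "w < 1" and ae: "AE x in lborel. f x = g x" and x: "f x = g x"
    and [measurable]: "f \<in> borel_measurable borel" "g \<in> borel_measurable borel"
  shows "ide_rhs \<Delta> w f x = ide_rhs \<Delta> w g x"
proof -
  have "gain_integral \<Delta> w f x = gain_integral \<Delta> w g x"
    unfolding gain_integral_def set_lebesgue_integral_def
    using ae AE_collision_partner[OF ae w, of x] by (intro integral_cong_AE) auto
  moreover have "near_mass \<Delta> f x = near_mass \<Delta> g x"
    unfolding near_mass_def set_lebesgue_integral_def
    using ae by (intro integral_cong_AE) auto
  ultimately show ?thesis using x by (simp add: ide_rhs_def)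
qed

lemma gain_near_of_bool:
  "gain_integral \<Delta> w g x = (LINT y|lborel. g ((x - (1 - w) * y) / w) * g y * of_bool (\<bar>x - y\<bar> \<le> \<Delta> * w))"
  "near_mass \<Delta> g x = (LINT y|lborel. g y * of_bool (\<bar>x - y\<bar> \<le> \<Delta>))"
  unfolding gain_integral_def near_mass_def set_lebesgue_integral_def
  by (auto intro!: Bochner_Integration.integral_cong simp: indicator_def abs_le_iff)

lemma integral_near_kernel:
  "(LINT y|lborel. g x * (g y * (h x * of_bool (\<bar>x - y\<bar> \<le> \<Delta>)))) = h x * (g x * near_mass \<Delta> g x)"
proof -
  have "(\<lambda>y. g x * (g y * (h x * of_bool (\<bar>x - y\<bar> \<le> \<Delta>)))) = (\<lambda>y. (h x * g x) * (g y * of_bool (\<bar>x - y\<bar> \<le> \<Delta>)))"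
    by (simp add: ac_simps)
  then show ?thesis by (simp add: gain_near_of_bool)
qed

lemma gain_near_nonneg:
  assumes "prob_density01 g"
  shows "0 \<le> gain_integral \<Delta> w g x" "0 \<le> near_mass \<Delta> g x" "near_mass \<Delta> g x \<le> 1"
proof -
  note g = prob_density01_simps[OF assms]
  show "0 \<le> gain_integral \<Delta> w g x" "0 \<le> near_mass \<Delta> g x"
    unfolding gain_near_of_bool using g by (auto intro!: integral_nonneg)
  have "near_mass \<Delta> g x \<le> (LINT y|lborel. g y)"
    unfolding near_mass_def set_lebesgue_integral_def
    using set_integrable_prob_density01[OF assms, of "{x - \<Delta>..x + \<Delta>}"] g
    by (intro integral_mono) (auto simp: set_integrable_def indicator_def)
  then show "near_mass \<Delta> g x \<le> 1" using g by simp
qed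

lemma measurable_gain_near:
  assumes [measurable]: "(\<lambda>(x, s). F x s) \<in> borel_measurable (borel \<Otimes>\<^sub>M borel)"
  shows "(\<lambda>z. gain_integral \<Delta> w (\<lambda>y. F y (snd z)) (fst z)) \<in> borel_measurable (borel \<Otimes>\<^sub>M borel)"
    "(\<lambda>z. near_mass \<Delta> (\<lambda>y. F y (snd z)) (fst z)) \<in> borel_measurable (borel \<Otimes>\<^sub>M borel)"
  unfolding gain_near_of_bool by measurable

section \<open>From the equation to Problem 1\<close>

lemma integrable_product_bounded_kernel:
  fixes \<kappa> :: "real \<times> real \<Rightarrow> real"
  assumes g: "prob_density01 g" and [measurable]: "\<kappa> \<in> borel_measurable (borel \<Otimes>\<^sub>M borel)" and C: "\<And>z. \<bar>\<kappa> z\<bar> \<le> C"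
  shows "integrable (lborel \<Otimes>\<^sub>M lborel) (\<lambda>z. g (fst z) * (g (snd z) * \<kappa> z))"
proof (rule integrableI_bounded)
  note [measurable] = prob_density01_simps(1)[OF g] and g' = prob_density01_simps[OF g]
  show "(\<lambda>z. g (fst z) * (g (snd z) * \<kappa> z)) \<in> borel_measurable (lborel \<Otimes>\<^sub>M lborel)"
    by measurable
  have C0: "0 \<le> C" using C[of undefined] by simp
  have "(\<integral>\<^sup>+z. ennreal (norm (g (fst z) * (g (snd z) * \<kappa> z))) \<partial>(lborel \<Otimes>\<^sub>M lborel)) \<le>
      (\<integral>\<^sup>+z. ennreal (g (fst z)) * (ennreal (g (snd z)) * ennreal C) \<partial>(lborel \<Otimes>\<^sub>M lborel))"
    using C g' C0
    by (intro nn_integral_mono) (auto simp: abs_mult ennreal_mult[symmetric] intro!: mult_left_mono ennreal_leI)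
  also have "\<dots> = (\<integral>\<^sup>+x. \<integral>\<^sup>+y. ennreal (g x) * (ennreal (g y) * ennreal C) \<partial>lborel \<partial>lborel)"
    by (subst lborel.nn_integral_fst[symmetric]) auto
  also have "\<dots> = ennreal C"
    using g'(6) by (simp add: nn_integral_cmult nn_integral_multc)
  also have "\<dots> < \<infinity>" by simp
  finally show "(\<integral>\<^sup>+z. ennreal (norm (g (fst z) * (g (snd z) * \<kappa> z))) \<partial>(lborel \<Otimes>\<^sub>M lborel)) < \<infinity>" .
qed

text \<open>The version of the change of variables for signed test functions. Fubini's theorem applies because
both descriptions of the pair are integrable on the product space.\<close>
lemma gain_integral_weak:
  fixes h :: "real \<Rightarrow> real"
  assumes w: "0 < w" "w < 1" and g: "prob_density01 g"
    and [measurable]: "h \<in> borel_measurable borel" and C: "\<And>x. \<bar>h x\<bar> \<le> C"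
  shows "integrable lborel (\<lambda>x. h x * gain_integral \<Delta> w g x)"
    "(LINT x|lborel. h x * gain_integral \<Delta> w g x) =
      w * (LINT x|lborel. LINT y|lborel. g x * (g y * (h (w * x + (1 - w) * y) * of_bool (\<bar>x - y\<bar> \<le> \<Delta>))))"
proof -
  note [measurable] = prob_density01_simps(1)[OF g] and g' = prob_density01_simps[OF g]
  define \<Phi> where "\<Phi> = (\<lambda>(x, y). h x * (g ((x - (1 - w) * y) / w) * g y * of_bool (\<bar>x - y\<bar> \<le> \<Delta> * w)))"
  define \<Psi> where "\<Psi> = (\<lambda>z. g (fst z) * (g (snd z) * (h (w * fst z + (1 - w) * snd z) * of_bool (\<bar>fst z - snd z\<bar> \<le> \<Delta>))))"
  have [measurable]: "\<Phi> \<in> borel_measurable (borel \<Otimes>\<^sub>M borel)"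
    unfolding \<Phi>_def by measurable
  have C0: "0 \<le> C" using C[of undefined] by simp
  have \<Psi>: "integrable (lborel \<Otimes>\<^sub>M lborel) \<Psi>"
    unfolding \<Psi>_def using C C0
    by (intro integrable_product_bounded_kernel[OF g, where C=C]) (auto simp: abs_mult)
  have \<Phi>: "integrable (lborel \<Otimes>\<^sub>M lborel) \<Phi>"
  proof (rule integrableI_bounded)
    show "\<Phi> \<in> borel_measurable (lborel \<Otimes>\<^sub>M lborel)" by simp
    have "(\<integral>\<^sup>+z. ennreal (norm (\<Phi> z)) \<partial>(lborel \<Otimes>\<^sub>M lborel)) = (\<integral>\<^sup>+x. \<integral>\<^sup>+y. ennreal (norm (\<Phi> (x, y))) \<partial>lborel \<partial>lborel)"
      by (subst lborel.nn_integral_fst[symmetric]) auto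
    also have "\<dots> \<le> (\<integral>\<^sup>+x. \<integral>\<^sup>+y. ennreal C * (ennreal (g ((x - (1 - w) * y) / w)) * ennreal (g y) * indicator {x - \<Delta> * w .. x + \<Delta> * w} y) \<partial>lborel \<partial>lborel)"
      using C C0 g' 
      by (intro nn_integral_mono) (auto simp: \<Phi>_def abs_mult ennreal_mult[symmetric] indicator_def abs_le_iff intro!: mult_right_mono ennreal_leI)
    also have "\<dots> = (\<integral>\<^sup>+x. ennreal C * (\<integral>\<^sup>+y. ennreal (g ((x - (1 - w) * y) / w)) * ennreal (g y) * indicator {x - \<Delta> * w .. x + \<Delta> * w} y \<partial>lborel) \<partial>lborel)"
      by (intro nn_integral_cong nn_integral_cmult) measurable
    also have "\<dots> = ennreal w * (\<integral>\<^sup>+x. \<integral>\<^sup>+y. ennreal C * (ennreal (g x) * ennreal (g y)) * indicator {x - \<Delta> .. x + \<Delta>} y \<partial>lborel \<partial>lborel)"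
      using nn_integral_collision_change[OF w(1), of "\<lambda>_. ennreal C" "\<lambda>x. ennreal (g x)" "\<lambda>x. ennreal (g x)" \<Delta>] by simp
    also have "\<dots> \<le> ennreal w * (\<integral>\<^sup>+x. \<integral>\<^sup>+y. ennreal C * (ennreal (g x) * ennreal (g y)) \<partial>lborel \<partial>lborel)"
      by (intro mult_left_mono nn_integral_mono) (auto simp: indicator_def)
    also have "\<dots> = ennreal w * ennreal C"
      using g'(6) by (simp add: nn_integral_cmult)
    also have "\<dots> < \<infinity>" by (simp add: ennreal_mult_less_top)
    finally show "(\<integral>\<^sup>+z. ennreal (norm (\<Phi> z)) \<partial>(lborel \<Otimes>\<^sub>M lborel)) < \<infinity>" .
  qed
  have inner: "(LINT y|lborel. \<Phi> (x, y)) = h x * gain_integral \<Delta> w g x" for x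
    by (simp add: \<Phi>_def gain_near_of_bool)
  show "integrable lborel (\<lambda>x. h x * gain_integral \<Delta> w g x)"
    using lborel_pair.integrable_fst'[OF \<Phi>] by (simp add: inner)
  note iff = collision_distance_iff[OF w(1)]
  have shift: "(LINT x|lborel. \<Phi> (x, y)) = w * (LINT x|lborel. \<Psi> (x, y))" for y
  proof -
    have "(LINT x|lborel. \<Phi> (x, y)) = \<bar>w\<bar> *\<^sub>R (LINT x|lborel. \<Phi> ((1 - w) * y + w * x, y))"
      using w by (intro lborel_integral_real_affine) simp
    also have "(LINT x|lborel. \<Phi> ((1 - w) * y + w * x, y)) = (LINT x|lborel. \<Psi> (x, y))"
      unfolding \<Phi>_def \<Psi>_def prod.case fst_conv snd_conv iff
      using w by (intro Bochner_Integration.integral_cong refl) (simp add: add.commute[of "w * _"])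
    finally show ?thesis using w by simp
  qed
  have "(LINT x|lborel. h x * gain_integral \<Delta> w g x) = (LINT x|lborel. LINT y|lborel. \<Phi> (x, y))"
    by (simp add: inner)
  also have "\<dots> = (LINT y|lborel. LINT x|lborel. \<Phi> (x, y))"
    using lborel_pair.Fubini_integral[of "\<lambda>x y. \<Phi> (x, y)"] \<Phi> by simp
  also have "\<dots> = w * (LINT y|lborel. LINT x|lborel. \<Psi> (x, y))"
    by (simp add: shift)
  also have "(LINT y|lborel. LINT x|lborel. \<Psi> (x, y)) = (LINT x|lborel. LINT y|lborel. \<Psi> (x, y))"
    using lborel_pair.Fubini_integral[of "\<lambda>x y. \<Psi> (x, y)"] \<Psi> by simp
  finally show "(LINT x|lborel. h x * gain_integral \<Delta> w g x) =
      w * (LINT x|lborel. LINT y|lborel. g x * (g y * (h (w * x + (1 - w) * y) * of_bool (\<bar>x - y\<bar> \<le> \<Delta>))))"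
    by (simp add: \<Psi>_def)
qed

lemma integrable_ide_rhs:
  fixes h :: "real \<Rightarrow> real"
  assumes w: "0 < w" "w < 1" and g: "prob_density01 g"
    and [measurable]: "h \<in> borel_measurable borel" and C: "\<And>x. \<bar>h x\<bar> \<le> C"
  shows "integrable lborel (\<lambda>x. h x * ide_rhs \<Delta> w g x)"
    "integrable lborel (\<lambda>x. h x * (g x * near_mass \<Delta> g x))"
proof -
  note [measurable] = prob_density01_simps(1)[OF g]
  let ?L = "\<lambda>z. g (fst z) * (g (snd z) * (h (fst z) * of_bool (\<bar>fst z - snd z\<bar> \<le> \<Delta>)))"
  have C0: "0 \<le> C" using C[of undefined] by simp
  have "integrable (lborel \<Otimes>\<^sub>M lborel) ?L"
    using C C0 by (intro integrable_product_bounded_kernel[OF g, where C=C]) (auto simp: abs_mult)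
  then have "integrable lborel (\<lambda>x. LINT y|lborel. ?L (x, y))"
    by (rule lborel_pair.integrable_fst')
  then show L: "integrable lborel (\<lambda>x. h x * (g x * near_mass \<Delta> g x))"
    by (simp only: integral_near_kernel fst_conv snd_conv)
  have "(\<lambda>x. h x * ide_rhs \<Delta> w g x) =
      (\<lambda>x. 2 / w * (h x * gain_integral \<Delta> w g x) - 2 * (h x * (g x * near_mass \<Delta> g x)))"
    by (auto simp: ide_rhs_def algebra_simps)
  then show "integrable lborel (\<lambda>x. h x * ide_rhs \<Delta> w g x)"
    using L gain_integral_weak(1)[OF w g assms(4) C, of \<Delta>]
    by (simp only:) (intro Bochner_Integration.integrable_diff integrable_mult_right; simp)
qed

text \<open>Gain and loss both have total mass at most 2. That the bound is independent of \<open>g\<close> makes the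
right-hand side integrable over a bounded time interval.\<close>
lemma integral_abs_ide_rhs_le:
  assumes w: "0 < w" "w < 1" and g: "prob_density01 g"
  shows "(LINT x|lborel. \<bar>ide_rhs \<Delta> w g x\<bar>) \<le> 4"
proof -
  note [measurable] = prob_density01_simps(1)[OF g] and g' = prob_density01_simps[OF g]
  have I: "integrable lborel (\<lambda>x. gain_integral \<Delta> w g x)" "integrable lborel (\<lambda>x. g x * near_mass \<Delta> g x)"
    "integrable lborel (\<lambda>x. ide_rhs \<Delta> w g x)"
    using gain_integral_weak(1)[OF w g, of "\<lambda>_. 1" 1 \<Delta>] integrable_ide_rhs[OF w g, of "\<lambda>_. 1" 1 \<Delta>] by auto
  have inner: "(LINT y|lborel. g x * (g y * (1 * of_bool (\<bar>x - y\<bar> \<le> \<Delta>)))) = g x * near_mass \<Delta> g x" for x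
    by (simp add: gain_near_of_bool)
  have near_le: "(LINT x|lborel. g x * near_mass \<Delta> g x) \<le> 1"
  proof -
    have "(LINT x|lborel. g x * near_mass \<Delta> g x) \<le> (LINT x|lborel. g x)"
      using I g' gain_near_nonneg[OF g] by (intro integral_mono) (auto intro: mult_left_le)
    then show ?thesis using g' by simp
  qed
  moreover have "(LINT x|lborel. gain_integral \<Delta> w g x) = w * (LINT x|lborel. g x * near_mass \<Delta> g x)"
    using gain_integral_weak(2)[OF w g, of "\<lambda>_. 1" 1 \<Delta>] by (simp only: inner) simp
  moreover have "(LINT x|lborel. \<bar>ide_rhs \<Delta> w g x\<bar>) \<le>
      (LINT x|lborel. 2 / w * gain_integral \<Delta> w g x + 2 * (g x * near_mass \<Delta> g x))"
  proof (intro integral_mono)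
    show "\<bar>ide_rhs \<Delta> w g x\<bar> \<le> 2 / w * gain_integral \<Delta> w g x + 2 * (g x * near_mass \<Delta> g x)" for x
    proof -
      have "0 \<le> 2 / w * gain_integral \<Delta> w g x" "0 \<le> 2 * (g x * near_mass \<Delta> g x)"
        using gain_near_nonneg[OF g] g' w by auto
      then show ?thesis by (simp add: ide_rhs_def abs_le_iff)
    qed
  qed (use I in auto)
  moreover have "(LINT x|lborel. 2 / w * gain_integral \<Delta> w g x + 2 * (g x * near_mass \<Delta> g x)) =
      2 / w * (LINT x|lborel. gain_integral \<Delta> w g x) + 2 * (LINT x|lborel. g x * near_mass \<Delta> g x)"
    using I by simp
  ultimately show ?thesis using w by simp
qed

lemma interaction_measure01_of:
  fixes h :: "real \<Rightarrow> real"
  assumes w: "0 < w" "w < 1" and g: "prob_density01 g"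
    and [measurable]: "h \<in> borel_measurable borel" and C: "\<And>x. \<bar>h x\<bar> \<le> C"
  shows "interaction \<Delta> w h (measure01_of g) = (LINT x|lborel. h x * ide_rhs \<Delta> w g x)"
proof -
  note [measurable] = prob_density01_simps(1)[OF g] and g' = prob_density01_simps[OF g]
  let ?K = "\<lambda>x y. (h (w * x + (1 - w) * y) - h x) * of_bool (\<bar>x - y\<bar> \<le> \<Delta>)"
  let ?P = "\<lambda>z. g (fst z) * (g (snd z) * (h (w * fst z + (1 - w) * snd z) * of_bool (\<bar>fst z - snd z\<bar> \<le> \<Delta>)))"
  let ?N = "\<lambda>z. g (fst z) * (g (snd z) * (h (fst z) * of_bool (\<bar>fst z - snd z\<bar> \<le> \<Delta>)))"
  have C0: "0 \<le> C" using C[of undefined] by simp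
  have P: "integrable (lborel \<Otimes>\<^sub>M lborel) ?P"
    using C C0 by (intro integrable_product_bounded_kernel[OF g, where C=C]) (auto simp: abs_mult)
  have N: "integrable (lborel \<Otimes>\<^sub>M lborel) ?N"
    using C C0 by (intro integrable_product_bounded_kernel[OF g, where C=C]) (auto simp: abs_mult)
  have n: "(LINT y|lborel. ?N (x, y)) = h x * (g x * near_mass \<Delta> g x)" for x
    by (simp only: integral_near_kernel fst_conv snd_conv)
  have "(LINT x|measure01_of g. LINT y|measure01_of g. ?K x y) = (LINT x|lborel. g x * (LINT y|lborel. g y * ?K x y))"
    by (simp add: LINT_measure01_of[OF g])
  also have "\<dots> = (LINT x|lborel. LINT y|lborel. ?P (x, y) - ?N (x, y))"
    by (subst integral_mult_right_zero[symmetric]) (simp add: algebra_simps)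
  also have "\<dots> = integral\<^sup>L (lborel \<Otimes>\<^sub>M lborel) (\<lambda>z. ?P z - ?N z)"
    using lborel_pair.integral_fst'[OF Bochner_Integration.integrable_diff[OF P N]] by simp
  also have "\<dots> = (LINT x|lborel. LINT y|lborel. ?P (x, y)) - (LINT x|lborel. LINT y|lborel. ?N (x, y))"
    using P N lborel_pair.integral_fst'[OF P] lborel_pair.integral_fst'[OF N] by simp
  also have "(LINT x|lborel. LINT y|lborel. ?N (x, y)) = (LINT x|lborel. h x * (g x * near_mass \<Delta> g x))"
    by (simp only: n)
  finally have "interaction \<Delta> w h (measure01_of g) =
      2 / w * (LINT x|lborel. h x * gain_integral \<Delta> w g x) - 2 * (LINT x|lborel. h x * (g x * near_mass \<Delta> g x))"
    using w gain_integral_weak(2)[OF w g assms(4) C, of \<Delta>] by (simp add: interaction_def)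
  also have "\<dots> = (LINT x|lborel. 2 / w * (h x * gain_integral \<Delta> w g x) - 2 * (h x * (g x * near_mass \<Delta> g x)))"
    using gain_integral_weak(1)[OF w g assms(4) C, of \<Delta>] integrable_ide_rhs(2)[OF w g assms(4) C, of \<Delta>] by simp
  also have "\<dots> = (LINT x|lborel. h x * ide_rhs \<Delta> w g x)"
    by (intro Bochner_Integration.integral_cong) (auto simp: ide_rhs_def algebra_simps)
  finally show ?thesis .
qed

lemma interaction_cong:
  assumes "M \<in> prob_measures01" "0 < w" "w < 1" "\<And>x. x \<in> {0..1} \<Longrightarrow> h x = k x"
  shows "interaction \<Delta> w h M = interaction \<Delta> w k M"
  unfolding interaction_def
  using assms(4) convex_combination_in_unit_interval[OF _ _ assms(2,3)] prob_measures01_simps(3)[OF assms(1)]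
  by (intro arg_cong2[where f="(*)"] Bochner_Integration.integral_cong refl) auto

text \<open>A Caratheodory function is the pointwise limit of the functions that are obtained by rounding the
second argument down to a multiple of \<open>1 / n\<close>, and these are jointly measurable because they depend on
the second argument only through countably many values.\<close>
lemma measurable_Caratheodory:
  fixes F :: "'a \<Rightarrow> real \<Rightarrow> real"
  assumes meas: "\<And>s. (\<lambda>x. F x s) \<in> borel_measurable M"
    and cont: "\<And>x. x \<in> space M \<Longrightarrow> continuous_on UNIV (F x)"
  shows "(\<lambda>(x, s). F x s) \<in> borel_measurable (M \<Otimes>\<^sub>M borel)"
proof (rule borel_measurable_LIMSEQ_real)
  let ?r = "\<lambda>n s :: real. real_of_int \<lfloor>real (Suc n) * s\<rfloor> / real (Suc n)"
  have r: "(\<lambda>n. ?r n s) \<longlonglongrightarrow> s" for s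
  proof (rule tendsto_sandwich)
    show "(\<lambda>n. s - 1 / real (Suc n)) \<longlonglongrightarrow> s"
      using tendsto_diff[OF tendsto_const LIMSEQ_inverse_real_of_nat, of s] by (simp add: inverse_eq_divide)
    show "(\<lambda>n. s) \<longlonglongrightarrow> s" by simp
    have "s - 1 / real (Suc n) \<le> ?r n s \<and> ?r n s \<le> s" for n
    proof -
      have "real (Suc n) * s - 1 \<le> real_of_int \<lfloor>real (Suc n) * s\<rfloor>" "real_of_int \<lfloor>real (Suc n) * s\<rfloor> \<le> real (Suc n) * s"
        by linarith+
      then have "(real (Suc n) * s - 1) / real (Suc n) \<le> ?r n s" "?r n s \<le> real (Suc n) * s / real (Suc n)"
        by (intro divide_right_mono; simp)+
      moreover have "(real (Suc n) * s - 1) / real (Suc n) = s - 1 / real (Suc n)" "real (Suc n) * s / real (Suc n) = s"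
        by (simp_all add: diff_divide_distrib del: of_nat_Suc)
      ultimately show ?thesis by metis
    qed
    then show "\<forall>\<^sub>F n in sequentially. s - 1 / real (Suc n) \<le> ?r n s" "\<forall>\<^sub>F n in sequentially. ?r n s \<le> s"
      by auto
  qed
  fix z assume "z \<in> space (M \<Otimes>\<^sub>M (borel :: real measure))"
  then have "isCont (F (fst z)) (snd z)"
    using cont[of "fst z"] by (auto simp: space_pair_measure continuous_on_eq_continuous_at)
  then show "(\<lambda>n. F (fst z) (?r n (snd z))) \<longlonglongrightarrow> (case z of (x, s) \<Rightarrow> F x s)"
    using isCont_tendsto_compose[OF _ r] by (simp add: case_prod_unfold)
next
  fix n :: nat
  show "(\<lambda>z. F (fst z) (real_of_int \<lfloor>real (Suc n) * snd z\<rfloor> / real (Suc n))) \<in> borel_measurable (M \<Otimes>\<^sub>M borel)"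
  proof (rule measurable_compose_countable[of "\<lambda>i z. F (fst z) (real_of_int i / real (Suc n))"])
    show "(\<lambda>z. F (fst z) (real_of_int i / real (Suc n))) \<in> borel_measurable (M \<Otimes>\<^sub>M borel)" for i
      using measurable_compose[OF measurable_fst meas] .
    show "(\<lambda>z. \<lfloor>real (Suc n) * snd z\<rfloor>) \<in> measurable (M \<Otimes>\<^sub>M borel) (count_space UNIV)"
      by measurable
  qed
qed

theorem ide_solution_solves_problem1:
  assumes w: "0 < w" "w < 1" and ide: "solves_ide \<Delta> w f" and dens: "\<And>t. 0 \<le> t \<Longrightarrow> prob_density01 (\<lambda>x. f x t)"
  shows "solves_problem1 \<Delta> w (measure01_of (\<lambda>x. f x 0)) (\<lambda>t. measure01_of (\<lambda>x. f x t))"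
proof -
  obtain N where N: "N \<in> sets lborel" "emeasure lborel N = 0"
    and deriv_f: "\<And>x t. x \<notin> N \<Longrightarrow> 0 \<le> t \<Longrightarrow>
      ((\<lambda>s. f x s) has_real_derivative ide_rhs \<Delta> w (\<lambda>y. f y t) x) (at t within {0..})"
    using ide[unfolded solves_ide_def] 
    by (elim AE_E) (fastforce simp: ide_rhs_def gain_integral_def near_mass_def)
  have [measurable]: "N \<in> sets borel" using N by simp
  have AE_N: "AE x in lborel. x \<notin> N"
    using N by (intro AE_not_in) (auto simp: null_sets_def)
  \<comment> \<open>On the null set \<open>N\<close> and at negative times \<open>F\<close> is redefined so that every \<open>F x\<close> is continuous
    on the whole line; this changes no density at a time \<open>t \<ge> 0\<close> except on \<open>N\<close>.\<close>
  define F where "F = (\<lambda>x s. if x \<in> N then 0 else f x (max 0 s))"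
  let ?m = "\<lambda>t. measure01_of (\<lambda>x. f x t)"
  let ?R = "\<lambda>x s. ide_rhs \<Delta> w (\<lambda>y. F y s) x"
  have F_AE: "AE x in lborel. F x s = f x (max 0 s)" for s
    using AE_N by eventually_elim (simp add: F_def)
  have F_dens: "prob_density01 (\<lambda>x. F x s)" for s
  proof (rule prob_density01I)
    note d = prob_density01_simps[OF dens, of "max 0 s"]
    note [measurable] = d(1)[simplified]
    show "(\<lambda>x. F x s) \<in> borel_measurable borel" unfolding F_def by measurable
    show "0 \<le> F x s" for x using d(2) by (simp add: F_def)
    show "F x s = 0" if "x \<notin> {0..1}" for x using d(3)[of x] that by (simp add: F_def)
    have "(\<integral>\<^sup>+x. ennreal (F x s) \<partial>lborel) = (\<integral>\<^sup>+x. ennreal (f x (max 0 s)) \<partial>lborel)"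
      using F_AE[of s] by (intro nn_integral_cong_AE) auto
    then show "(\<integral>\<^sup>+x. ennreal (F x s) \<partial>lborel) = 1" using d(6) by simp
  qed
  have F_cont: "continuous_on UNIV (F x)" for x
  proof (cases "x \<in> N")
    case False
    have "continuous_on {0..} (f x)"
      using deriv_f[OF False] DERIV_continuous by (fastforce simp: continuous_on_eq_continuous_within)
    then have "continuous_on UNIV (\<lambda>s. f x (max 0 s))"
      by (rule continuous_on_compose2) (auto intro: continuous_intros)
    then show ?thesis using False by (simp add: F_def)
  qed (simp add: F_def)
  have F_meas: "(\<lambda>(x, s). F x s) \<in> borel_measurable (borel \<Otimes>\<^sub>M borel)"
    using prob_density01_simps(1)[OF F_dens] F_cont by (intro measurable_Caratheodory)
  have R_meas [measurable]: "(\<lambda>z. ?R (fst z) (snd z)) \<in> borel_measurable (borel \<Otimes>\<^sub>M borel)"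
  proof -
    note [measurable] = F_meas measurable_gain_near[OF F_meas]
    show ?thesis unfolding ide_rhs_def by measurable
  qed
  have m_eq: "?m t = measure01_of (\<lambda>x. F x t)" if "0 \<le> t" for t
    using F_AE[of t] that prob_density01_simps(1)[OF dens] prob_density01_simps(1)[OF F_dens]
    by (intro measure01_of_cong_AE) (auto simp: max_absorb2)
  have deriv: "((\<lambda>s. F x s) has_real_derivative ?R x t) (at t within {0..})" if "x \<notin> N" "0 \<le> t" for x t
  proof -
    have "ide_rhs \<Delta> w (\<lambda>y. f y t) x = ?R x t"
      using F_AE[of t] that prob_density01_simps(1)[OF dens] prob_density01_simps(1)[OF F_dens]
      by (intro ide_rhs_cong_AE[OF w]) (auto simp: max_absorb2 F_def)
    with deriv_f[OF that] have "((\<lambda>s. f x s) has_real_derivative ?R x t) (at t within {0..})" by simp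
    then show ?thesis
      by (rule has_field_derivative_transform_within[OF _ zero_less_one])
        (use that in \<open>auto simp: F_def max_absorb2\<close>)
  qed
  \<comment> \<open>Integrability on the product, needed twice: it makes the time derivative Lebesgue integrable for
    almost every \<open>x\<close>, and it permits the exchange of the two integrals at the end.\<close>
  have J: "integrable (lborel \<Otimes>\<^sub>M lborel) (\<lambda>(x, s). indicator {0..t} s * (H x * ?R x s))"
    if [measurable]: "H \<in> borel_measurable borel" and C: "\<And>x. \<bar>H x\<bar> \<le> C" for H :: "real \<Rightarrow> real" and C t
  proof -
    have C0: "0 \<le> C" using C[of undefined] by simp
    have "integrable (lborel \<Otimes>\<^sub>M lborel) (\<lambda>z. indicator {0..t} (fst z) * (H (snd z) * ?R (snd z) (fst z)))"
    proof (rule lborel_pair.Fubini_integrable)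
      show meas: "(\<lambda>z. indicator {0..t} (fst z) * (H (snd z) * ?R (snd z) (fst z))) \<in> borel_measurable (lborel \<Otimes>\<^sub>M lborel)"
      proof -
        have [measurable]: "(\<lambda>z. ?R (snd z) (fst z)) \<in> borel_measurable (borel \<Otimes>\<^sub>M borel)"
          using measurable_compose[OF measurable_pair_swap' R_meas] by (simp add: case_prod_unfold)
        show ?thesis by measurable
      qed
      have int: "integrable lborel (\<lambda>x. H x * ?R x s)" for s
        by (rule integrable_ide_rhs(1)[OF w F_dens that])
      have int1: "integrable lborel (\<lambda>x. ?R x s)" for s
        using integrable_ide_rhs(1)[OF w F_dens, of "\<lambda>_. 1" 1] by simp
      have "integrable lborel (\<lambda>s. (4 * C) * indicator {0..t} s)"
        by (intro integrable_mult_right) (simp add: integrable_indicator_iff emeasure_lborel_Icc_eq)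
      then show "integrable lborel (\<lambda>s. LINT x|lborel. norm (indicator {0..t} (fst (s, x)) * (H (snd (s, x)) * ?R (snd (s, x)) (fst (s, x)))))"
      proof (rule Bochner_Integration.integrable_bound)
        show "(\<lambda>s. LINT x|lborel. norm (indicator {0..t} (fst (s, x)) * (H (snd (s, x)) * ?R (snd (s, x)) (fst (s, x))))) \<in> borel_measurable lborel"
          using measurable_compose[OF meas borel_measurable_norm] by (intro lborel.borel_measurable_lebesgue_integral) (simp add: case_prod_unfold)
        have "(LINT x|lborel. \<bar>H x * ?R x s\<bar>) \<le> 4 * C" for s
        proof -
          have "(LINT x|lborel. \<bar>H x * ?R x s\<bar>) \<le> (LINT x|lborel. C * \<bar>?R x s\<bar>)"
          proof (rule integral_mono)
            show "integrable lborel (\<lambda>x. \<bar>H x * ?R x s\<bar>)" using int[of s] by (rule integrable_abs)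
            show "integrable lborel (\<lambda>x. C * \<bar>?R x s\<bar>)" using int1[of s] by (intro integrable_mult_right integrable_abs)
            show "\<bar>H x * ?R x s\<bar> \<le> C * \<bar>?R x s\<bar>" for x using C by (simp add: abs_mult mult_right_mono)
          qed
          also have "\<dots> \<le> 4 * C"
            using integral_abs_ide_rhs_le[OF w F_dens, of \<Delta> s] C0 by (simp add: mult.commute mult_left_mono)
          finally show ?thesis .
        qed
        then show "AE s in lborel. norm (LINT x|lborel. norm (indicator {0..t} (fst (s, x)) * (H (snd (s, x)) * ?R (snd (s, x)) (fst (s, x))))) \<le> norm (4 * C * indicator {0..t} s)"
          using C0 by (intro AE_I2) (auto simp: abs_mult indicator_def)
      qed
      show "AE s in lborel. integrable lborel (\<lambda>x. indicator {0..t} (fst (s, x)) * (H (snd (s, x)) * ?R (snd (s, x)) (fst (s, x))))"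
        using int by simp
    qed
    from lborel_pair.integrable_product_swap[OF this] show ?thesis by simp
  qed
  have FTC: "AE x in lborel. (LINT s|lborel. indicator {0..t} s * ?R x s) = F x t - F x 0" if t: "0 \<le> t" for t
  proof -
    have "AE x in lborel. integrable lborel (\<lambda>s. indicator {0..t} s * ?R x s)"
      using lborel_pair.AE_integrable_fst'[OF J[of "\<lambda>_. 1" 1 t]] by simp
    with AE_N show ?thesis
    proof eventually_elim
      case (elim x)
      \<comment> \<open>An everywhere existing derivative always has a gauge integral, and the gauge and Lebesgue integrals
        agree because the latter exists by \<open>J\<close>.\<close>
      have "((\<lambda>s. ?R x s) has_integral (F x t - F x 0)) {0..t}"
      proof (rule fundamental_theorem_of_calculus[OF t])
        show "(F x has_vector_derivative ?R x s) (at s within {0..t})" if "s \<in> {0..t}" for s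
          using deriv[OF elim(1), of s] that
          by (auto simp: has_real_derivative_iff_has_vector_derivative[symmetric] intro: has_field_derivative_subset)
      qed
      then have "integral {0..t} (\<lambda>s. ?R x s) = F x t - F x 0" by (rule integral_unique)
      moreover have "set_integrable lborel {0..t} (\<lambda>s. ?R x s)"
        using elim(2) by (simp add: set_integrable_def)
      ultimately have "(LINT s:{0..t}|lborel. ?R x s) = F x t - F x 0"
        by (simp add: set_borel_integral_eq_integral(2))
      then show ?case by (simp add: set_lebesgue_integral_def)
    qed
  qed
  show ?thesis
    unfolding solves_problem1_def
  proof (intro conjI allI impI ballI refl)
    show "?m t \<in> prob_measures01" if "0 \<le> t" for t
      using dens[OF that] by (rule measure01_of_prob_measures01)
    fix h :: "real \<Rightarrow> real" and t :: real
    assume h: "h \<in> borel_measurable borel01" "bounded (h ` {0..1})" and t: "0 \<le> t"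
    define H where "H = (\<lambda>x. indicator {0..1} x * h x)"
    obtain C where C: "\<And>x. x \<in> {0..1} \<Longrightarrow> \<bar>h x\<bar> \<le> C"
      using h(2) unfolding bounded_iff real_norm_def by (metis imageI)
    then have C0: "0 \<le> C" using abs_ge_zero[of "h 0"] by (meson atLeastAtMost_iff order_refl order_trans zero_le_one)
    have H_meas [measurable]: "H \<in> borel_measurable borel"
      using h(1) by (simp add: H_def borel_measurable_restrict_space_iff)
    have H_le: "\<bar>H x\<bar> \<le> C" for x
      using C C0 by (auto simp: H_def indicator_def)
    have m_H: "(LINT x|?m t. h x) = (LINT x|lborel. F x t * H x)" if "0 \<le> t" for t
    proof -
      have "(LINT x|?m t. h x) = (LINT x|?m t. H x)"
        by (intro Bochner_Integration.integral_cong) (auto simp: space_measure01_of H_def)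
      then show ?thesis
        unfolding m_eq[OF that] LINT_measure01_of[OF F_dens H_meas] .
    qed
    have int_eq: "interaction \<Delta> w h (?m s) = (LINT x|lborel. H x * ?R x s)" if "0 \<le> s" for s
    proof -
      have "interaction \<Delta> w h (?m s) = interaction \<Delta> w H (?m s)"
        by (rule interaction_cong[OF measure01_of_prob_measures01[OF dens[OF that]] w]) (simp add: H_def)
      then show ?thesis
        unfolding m_eq[OF that] interaction_measure01_of[OF w F_dens H_meas H_le] .
    qed
    have ind_eq: "indicator {0..t} s *\<^sub>R interaction \<Delta> w h (?m s) = (LINT x|lborel. indicator {0..t} s * (H x * ?R x s))" for s
      using int_eq[of s] by (auto simp: indicator_def)
    note JH = J[OF H_meas H_le, of t]
    have "integrable lborel (\<lambda>s. LINT x|lborel. indicator {0..t} s * (H x * ?R x s))"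
      using lborel_pair.integrable_snd[OF JH] by simp
    then show "set_integrable lborel {0..t} (\<lambda>s. interaction \<Delta> w h (?m s))"
      by (simp only: set_integrable_def ind_eq)
    have FH: "integrable lborel (\<lambda>x. F x s * H x)" for s
    proof (rule Bochner_Integration.integrable_bound)
      note F' = prob_density01_simps[OF F_dens, of s]
      show "integrable lborel (\<lambda>x. C * F x s)" using F'(4) by simp
      show "(\<lambda>x. F x s * H x) \<in> borel_measurable lborel" using F'(1) by simp
      show "AE x in lborel. norm (F x s * H x) \<le> norm (C * F x s)"
        using F'(2) H_le C0 by (intro AE_I2) (auto simp: abs_mult mult.commute intro!: mult_right_mono)
    qed
    have "(LINT x|?m t. h x) - (LINT x|?m 0. h x) = (LINT x|lborel. F x t * H x - F x 0 * H x)"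
      using m_H[OF t] m_H[of 0] FH by simp
    also have "\<dots> = (LINT x|lborel. LINT s|lborel. indicator {0..t} s * (H x * ?R x s))"
    proof (intro integral_cong_AE)
      show "(\<lambda>x. LINT s|lborel. indicator {0..t} s * (H x * ?R x s)) \<in> borel_measurable lborel"
        using borel_measurable_integrable[OF JH] by (intro lborel.borel_measurable_lebesgue_integral) simp
      show "(\<lambda>x. F x t * H x - F x 0 * H x) \<in> borel_measurable lborel"
        using borel_measurable_integrable[OF FH] by simp
      show "AE x in lborel. F x t * H x - F x 0 * H x = (LINT s|lborel. indicator {0..t} s * (H x * ?R x s))"
        using FTC[OF t]
      proof eventually_elim
        case (elim x)
        have "(\<lambda>s. indicator {0..t} s * (H x * ?R x s)) = (\<lambda>s. H x * (indicator {0..t} s * ?R x s))"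
          by (simp add: ac_simps)
        then show ?case by (simp add: elim left_diff_distrib right_diff_distrib mult.commute)
      qed
    qed
    also have "\<dots> = (LINT s|lborel. LINT x|lborel. indicator {0..t} s * (H x * ?R x s))"
      by (rule lborel_pair.Fubini_integral[OF JH, symmetric])
    also have "\<dots> = (LINT s:{0..t}|lborel. interaction \<Delta> w h (?m s))"
      by (simp only: set_lebesgue_integral_def ind_eq)
    finally show "(LINT x|?m t. h x) - (LINT x|?m 0. h x) = (LINT s:{0..t}|lborel. interaction \<Delta> w h (?m s))" .
  qed
qed

section \<open>The Wild product\<close>

text \<open>For \<open>u = v\<close> this is half of the gain term plus \<open>u\<close> times the mass of \<open>v\<close> that is too far away to interact. Working with
values in \<open>[0, \<infinity>]\<close> makes all products and sums meaningful before anything is known to be finite.\<close>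
definition wild_product :: "real \<Rightarrow> real \<Rightarrow> (real \<Rightarrow> ennreal) \<Rightarrow> (real \<Rightarrow> ennreal) \<Rightarrow> real \<Rightarrow> ennreal" where
  "wild_product \<Delta> w u v x =
     ennreal (1 / w) * (\<integral>\<^sup>+y. u ((x - (1 - w) * y) / w) * v y * indicator {x - \<Delta> * w .. x + \<Delta> * w} y \<partial>lborel)
     + u x * (\<integral>\<^sup>+y. v y * indicator (- {x - \<Delta> .. x + \<Delta>}) y \<partial>lborel)"

lemma measurable_indicator_closed_interval [measurable]:
  assumes [measurable]: "f \<in> borel_measurable M" "a \<in> borel_measurable M" "b \<in> borel_measurable M"
  shows "(\<lambda>x. indicator {a x .. b x :: real} (f x) :: ennreal) \<in> borel_measurable M"
    "(\<lambda>x. indicator (- {a x .. b x}) (f x) :: ennreal) \<in> borel_measurable M"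
  unfolding indicator_def atLeastAtMost_iff Compl_iff by measurable

lemma measurable_wild_product [measurable]:
  assumes [measurable]: "u \<in> borel_measurable borel" "v \<in> borel_measurable borel"
  shows "wild_product \<Delta> w u v \<in> borel_measurable borel"
  unfolding wild_product_def by measurable

text \<open>After the change of variables, the first summand of the product integrates \<open>u(x) v(y)\<close> over the
interacting pairs and the second one over the remaining pairs.\<close>
lemma nn_integral_wild_product:
  assumes "0 < w" and [measurable]: "u \<in> borel_measurable borel" "v \<in> borel_measurable borel"
  shows "(\<integral>\<^sup>+x. wild_product \<Delta> w u v x \<partial>lborel) = (\<integral>\<^sup>+x. u x \<partial>lborel) * (\<integral>\<^sup>+y. v y \<partial>lborel)"
proof -
  have "(\<integral>\<^sup>+x. wild_product \<Delta> w u v x \<partial>lborel) =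
      ennreal (1 / w) * (ennreal w * (\<integral>\<^sup>+x. \<integral>\<^sup>+y. u x * v y * indicator {x - \<Delta> .. x + \<Delta>} y \<partial>lborel \<partial>lborel))
      + (\<integral>\<^sup>+x. \<integral>\<^sup>+y. u x * v y * indicator (- {x - \<Delta> .. x + \<Delta>}) y \<partial>lborel \<partial>lborel)"
    using nn_integral_collision_change[OF \<open>0 < w\<close>, of "\<lambda>_. 1" u v \<Delta>] unfolding wild_product_def
    by (subst nn_integral_add) (auto simp: nn_integral_cmult mult.assoc)
  also have "ennreal (1 / w) * (ennreal w * (\<integral>\<^sup>+x. \<integral>\<^sup>+y. u x * v y * indicator {x - \<Delta> .. x + \<Delta>} y \<partial>lborel \<partial>lborel))
      = (\<integral>\<^sup>+x. \<integral>\<^sup>+y. u x * v y * indicator {x - \<Delta> .. x + \<Delta>} y \<partial>lborel \<partial>lborel)"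
    using \<open>0 < w\<close> by (simp add: mult.assoc[symmetric] ennreal_mult'[symmetric])
  also have "\<dots> + (\<integral>\<^sup>+x. \<integral>\<^sup>+y. u x * v y * indicator (- {x - \<Delta> .. x + \<Delta>}) y \<partial>lborel \<partial>lborel) =
      (\<integral>\<^sup>+x. \<integral>\<^sup>+y. u x * v y * indicator {x - \<Delta> .. x + \<Delta>} y + u x * v y * indicator (- {x - \<Delta> .. x + \<Delta>}) y \<partial>lborel \<partial>lborel)"
    by (simp add: nn_integral_add)
  also have "\<dots> = (\<integral>\<^sup>+x. \<integral>\<^sup>+y. u x * v y \<partial>lborel \<partial>lborel)"
    by (intro nn_integral_cong) (auto simp: indicator_def)
  also have "\<dots> = (\<integral>\<^sup>+x. u x \<partial>lborel) * (\<integral>\<^sup>+y. v y \<partial>lborel)"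
    by (simp add: nn_integral_cmult nn_integral_multc)
  finally show ?thesis .
qed

lemma wild_product_outside:
  assumes w: "0 < w" "w < 1" and u: "\<And>x. x \<notin> {0..1} \<Longrightarrow> u x = 0" and v: "\<And>x. x \<notin> {0..1} \<Longrightarrow> v x = 0"
    and x: "x \<notin> {0..1}"
  shows "wild_product \<Delta> w u v x = 0"
proof -
  have "u ((x - (1 - w) * y) / w) * v y = 0" for y
  proof (rule ccontr)
    assume "u ((x - (1 - w) * y) / w) * v y \<noteq> 0"
    then have *: "(x - (1 - w) * y) / w \<in> {0..1}" "y \<in> {0..1}"
      using u v by (auto simp del: atLeastAtMost_iff)
    then have "w * ((x - (1 - w) * y) / w) + (1 - w) * y \<in> {0..1}"
      by (rule convex_combination_in_unit_interval[OF _ _ w])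
    then show False using x w by simp
  qed
  then have "(\<integral>\<^sup>+y. u ((x - (1 - w) * y) / w) * v y * indicator {x - \<Delta> * w .. x + \<Delta> * w} y \<partial>lborel) = 0"
    by (simp del: mult_eq_0_iff)
  then show ?thesis using u[OF x] by (simp add: wild_product_def)
qed

lemma wild_product_cong_AE:
  assumes w: "0 < w" "w < 1" and u: "AE x in lborel. u x = u' x" and v: "AE x in lborel. v x = v' x" and "u x = u' x"
  shows "wild_product \<Delta> w u v x = wild_product \<Delta> w u' v' x"
proof -
  have "(\<integral>\<^sup>+y. u ((x - (1 - w) * y) / w) * v y * indicator {x - \<Delta> * w .. x + \<Delta> * w} y \<partial>lborel) =
      (\<integral>\<^sup>+y. u' ((x - (1 - w) * y) / w) * v' y * indicator {x - \<Delta> * w .. x + \<Delta> * w} y \<partial>lborel)"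
    using v AE_collision_partner[OF u w, of x] by (intro nn_integral_cong_AE) auto
  moreover have "(\<integral>\<^sup>+y. v y * indicator (- {x - \<Delta> .. x + \<Delta>}) y \<partial>lborel) =
      (\<integral>\<^sup>+y. v' y * indicator (- {x - \<Delta> .. x + \<Delta>}) y \<partial>lborel)"
    using v by (intro nn_integral_cong_AE) auto
  ultimately show ?thesis using assms(5) by (simp add: wild_product_def)
qed

lemma wild_product_suminf:
  assumes [measurable]: "\<And>n. u n \<in> borel_measurable borel" "\<And>n. v n \<in> borel_measurable borel"
  shows "wild_product \<Delta> w (\<lambda>x. \<Sum>k. u k x) (\<lambda>x. \<Sum>l. v l x) x = (\<Sum>k. \<Sum>l. wild_product \<Delta> w (u k) (v l) x)"
proof -
  have *: "(\<integral>\<^sup>+y. (\<Sum>k. u k ((x - (1 - w) * y) / w)) * (\<Sum>l. v l y) * indicator {x - \<Delta> * w .. x + \<Delta> * w} y \<partial>lborel)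
      = (\<Sum>k. \<Sum>l. \<integral>\<^sup>+y. u k ((x - (1 - w) * y) / w) * v l y * indicator {x - \<Delta> * w .. x + \<Delta> * w} y \<partial>lborel)"
    by (simp add: nn_integral_suminf[symmetric])
  have **: "(\<integral>\<^sup>+y. (\<Sum>l. v l y) * indicator (- {x - \<Delta> .. x + \<Delta>}) y \<partial>lborel)
      = (\<Sum>l. \<integral>\<^sup>+y. v l y * indicator (- {x - \<Delta> .. x + \<Delta>}) y \<partial>lborel)"
    by (simp add: nn_integral_suminf[symmetric])
  show ?thesis
    unfolding wild_product_def * ** by (simp add: suminf_add[symmetric])
qed

lemma wild_product_cmult:
  assumes [measurable]: "u \<in> borel_measurable borel" "v \<in> borel_measurable borel"
  shows "wild_product \<Delta> w (\<lambda>x. a * u x) (\<lambda>x. b * v x) x = a * b * wild_product \<Delta> w u v x"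
proof -
  have *: "(\<integral>\<^sup>+y. a * u ((x - (1 - w) * y) / w) * (b * v y) * indicator {x - \<Delta> * w .. x + \<Delta> * w} y \<partial>lborel)
      = a * b * (\<integral>\<^sup>+y. u ((x - (1 - w) * y) / w) * v y * indicator {x - \<Delta> * w .. x + \<Delta> * w} y \<partial>lborel)"
    by (subst nn_integral_cmult[symmetric]) (auto intro!: nn_integral_cong simp: ac_simps)
  have **: "(\<integral>\<^sup>+y. (b * v y) * indicator (- {x - \<Delta> .. x + \<Delta>}) y \<partial>lborel)
      = b * (\<integral>\<^sup>+y. v y * indicator (- {x - \<Delta> .. x + \<Delta>}) y \<partial>lborel)"
    by (subst nn_integral_cmult[symmetric]) (auto intro!: nn_integral_cong simp: ac_simps)
  show ?thesis
    unfolding wild_product_def * ** by (simp add: algebra_simps)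
qed

lemma suminf_ennreal_Cauchy_product:
  fixes c :: "nat \<Rightarrow> nat \<Rightarrow> ennreal"
  shows "(\<Sum>k. \<Sum>l. c k l) = (\<Sum>n. \<Sum>k\<le>n. c k (n - k))"
proof -
  have "(\<Sum>l. c k l) = (\<Sum>n. c k (n - k) * of_bool (k \<le> n))" for k
    using suminf_offset[of "\<lambda>n. c k (n - k) * of_bool (k \<le> n)" k] by simp
  then have "(\<Sum>k. \<Sum>l. c k l) = (\<Sum>k. \<Sum>n. c k (n - k) * of_bool (k \<le> n))"
    by simp
  \<comment> \<open>Tonelli for counting measure.\<close>
  also have "\<dots> = (\<Sum>n. \<Sum>k. c k (n - k) * of_bool (k \<le> n))"
    using nn_integral_suminf[of "\<lambda>k n. c k (n - k) * of_bool (k \<le> n)" "count_space UNIV"]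
    by (simp add: nn_integral_count_space_nat)
  also have "\<dots> = (\<Sum>n. \<Sum>k\<le>n. c k (n - k))"
  proof (rule suminf_cong)
    fix n
    show "(\<Sum>k. c k (n - k) * of_bool (k \<le> n)) = (\<Sum>k\<le>n. c k (n - k))"
      by (subst suminf_finite[of "{..n}"]) auto
  qed
  finally show ?thesis .
qed

text \<open>The equation \<open>f' = 2 B(f, f) - 2 f\<close> agrees with the integro-differential equation because \<open>g\<close> has mass
1: the mass of the distant points is \<open>1 - near_mass \<Delta> g x\<close>. Finiteness of the product at \<open>x\<close> gives the
integrability of the gain integrand.\<close>
lemma wild_product_eq_real:
  assumes g: "prob_density01 g" and w: "0 < w" and "0 \<le> E"
    and E: "wild_product \<Delta> w (\<lambda>x. ennreal (g x)) (\<lambda>x. ennreal (g x)) x = ennreal E"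
  shows "set_integrable lborel {x - \<Delta> * w .. x + \<Delta> * w} (\<lambda>y. g ((x - (1 - w) * y) / w) * g y)"
    "E = 1 / w * gain_integral \<Delta> w g x + g x * (1 - near_mass \<Delta> g x)"
proof -
  note [measurable] = prob_density01_simps(1)[OF g]
  note g0 = prob_density01_simps(2)[OF g]
  let ?I = "{x - \<Delta> * w .. x + \<Delta> * w}" and ?J = "{x - \<Delta> .. x + \<Delta>}"
  let ?gg = "\<lambda>y. g ((x - (1 - w) * y) / w) * g y"
  let ?G = "\<integral>\<^sup>+y. ennreal (indicator ?I y *\<^sub>R ?gg y) \<partial>lborel"
  have fin: "?G < \<infinity>" and sum: "ennreal E = ennreal (1 / w) * ?G + ennreal (g x) * (\<integral>\<^sup>+y. ennreal (indicator (- ?J) y *\<^sub>R g y) \<partial>lborel)"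
  proof -
    show "ennreal E = ennreal (1 / w) * ?G + ennreal (g x) * (\<integral>\<^sup>+y. ennreal (indicator (- ?J) y *\<^sub>R g y) \<partial>lborel)"
      unfolding E[symmetric] wild_product_def using g0
      by (intro arg_cong2[where f="(+)"] arg_cong2[where f="(*)"] nn_integral_cong refl)
         (auto simp: indicator_def ennreal_mult')
    then have "ennreal (1 / w) * ?G \<le> ennreal E"
      by (simp only: add_increasing2 zero_le order_refl)
    also have "\<dots> < \<top>" by (rule ennreal_less_top)
    finally show "?G < \<infinity>" using w by (auto simp: ennreal_mult_less_top)
  qed
  have int: "integrable lborel (\<lambda>y. indicator ?I y *\<^sub>R ?gg y)"
    using fin g0 by (intro integrableI_nonneg) auto
  then show "set_integrable lborel ?I ?gg" by (simp add: set_integrable_def)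
  have G: "?G = ennreal (gain_integral \<Delta> w g x)"
    unfolding gain_integral_def set_lebesgue_integral_def using int g0
    by (intro nn_integral_eq_integral) auto
  have J: "set_integrable lborel ?J g" "set_integrable lborel (- ?J) g"
    using set_integrable_prob_density01[OF g] by auto
  have "(LINT y:?J \<union> - ?J|lborel. g y) = (LINT y:?J|lborel. g y) + (LINT y:- ?J|lborel. g y)"
    using J by (intro set_integral_Un) auto
  then have far: "(LINT y:- ?J|lborel. g y) = 1 - near_mass \<Delta> g x"
    using prob_density01_simps(5)[OF g] by (simp add: set_lebesgue_integral_def near_mass_def)
  have H: "(\<integral>\<^sup>+y. ennreal (indicator (- ?J) y *\<^sub>R g y) \<partial>lborel) = ennreal (1 - near_mass \<Delta> g x)"
    unfolding far[symmetric] set_lebesgue_integral_def using J g0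
    by (intro nn_integral_eq_integral) (auto simp: set_integrable_def)
  have nn: "0 \<le> gain_integral \<Delta> w g x" "0 \<le> 1 - near_mass \<Delta> g x"
    unfolding far[symmetric] gain_integral_def set_lebesgue_integral_def using g0
    by (auto intro!: integral_nonneg)
  have "ennreal E = ennreal (1 / w * gain_integral \<Delta> w g x + g x * (1 - near_mass \<Delta> g x))"
    unfolding sum G H using nn g0[of x] w
    by (simp only: ennreal_mult[symmetric] ennreal_plus[symmetric] mult_nonneg_nonneg
        divide_nonneg_pos zero_le_one)
  then show "E = 1 / w * gain_integral \<Delta> w g x + g x * (1 - near_mass \<Delta> g x)"
    using nn g0 w \<open>0 \<le> E\<close> by (subst (asm) ennreal_inj) auto
qed

section \<open>The Wild sum\<close>

text \<open>The coefficients \<open>u\<^sub>n\<close> of the Wild sum. The congruence rule for sums provides \<open>k \<le> n\<close> in the termination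
proof.\<close>
context notes sum.cong [fundef_cong] begin
fun wild :: "real \<Rightarrow> real \<Rightarrow> (real \<Rightarrow> ennreal) \<Rightarrow> nat \<Rightarrow> real \<Rightarrow> ennreal" where
  "wild \<Delta> w g 0 = g"
| "wild \<Delta> w g (Suc n) =
     (\<lambda>x. (\<Sum>k\<le>n. wild_product \<Delta> w (wild \<Delta> w g k) (wild \<Delta> w g (n - k)) x) / of_nat (Suc n))"
end

lemma measurable_wild [measurable]:
  assumes "g \<in> borel_measurable borel"
  shows "wild \<Delta> w g n \<in> borel_measurable borel"
proof (induction n rule: less_induct)
  case (less n)
  show ?case
  proof (cases n)
    case (Suc m)
    then have [measurable]: "wild \<Delta> w g k \<in> borel_measurable borel"
      "wild \<Delta> w g (m - k) \<in> borel_measurable borel" if "k \<in> {..m}" for k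
      using that less by auto
    show ?thesis unfolding Suc wild.simps by measurable
  qed (use assms in simp)
qed

lemma nn_integral_wild:
  assumes "0 < w" and g: "g \<in> borel_measurable borel" "(\<integral>\<^sup>+x. g x \<partial>lborel) = 1"
  shows "(\<integral>\<^sup>+x. wild \<Delta> w g n x \<partial>lborel) = 1"
proof (induction n rule: less_induct)
  case (less n)
  show ?case
  proof (cases n)
    case (Suc m)
    note [measurable] = measurable_wild[OF g(1)]
    have "(\<integral>\<^sup>+x. wild \<Delta> w g n x \<partial>lborel) =
        (\<Sum>k\<le>m. \<integral>\<^sup>+x. wild_product \<Delta> w (wild \<Delta> w g k) (wild \<Delta> w g (m - k)) x \<partial>lborel) / of_nat (Suc m)"
      unfolding Suc wild.simps by (simp add: nn_integral_divide nn_integral_sum)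
    also have "\<dots> = (\<Sum>k\<le>m. 1) / of_nat (Suc m)"
      using less Suc by (intro arg_cong2[where f="(/)"] sum.cong) (auto simp: nn_integral_wild_product \<open>0 < w\<close>)
    also have "\<dots> = 1"
      using ennreal_divide_self[of "of_nat (Suc m)"] by (simp add: of_nat_less_top del: of_nat_Suc)
    finally show ?thesis .
  qed (use assms in simp)
qed

lemma wild_outside:
  assumes w: "0 < w" "w < 1" and g: "\<And>x. x \<notin> {0..1} \<Longrightarrow> g x = 0" and x: "x \<notin> {0..1}"
  shows "wild \<Delta> w g n x = 0"
  using x
proof (induction n arbitrary: x rule: less_induct)
  case (less n)
  show ?case
  proof (cases n)
    case (Suc m)
    have "wild_product \<Delta> w (wild \<Delta> w g k) (wild \<Delta> w g (m - k)) x = 0" if "k \<le> m" for k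
      using that Suc less by (intro wild_product_outside w) auto
    then show ?thesis unfolding Suc wild.simps by simp
  qed (use less g in simp)
qed

definition wild_series :: "real \<Rightarrow> real \<Rightarrow> (real \<Rightarrow> ennreal) \<Rightarrow> real \<Rightarrow> real \<Rightarrow> ennreal" where
  "wild_series \<Delta> w g \<tau> x = (\<Sum>n. ennreal (\<tau> ^ n) * wild \<Delta> w g n x)"

text \<open>The points at which the power series \<open>\<Sum>\<^sub>n \<tau>^n u\<^sub>n(x)\<close> has radius of convergence at least 1. A sequence of
values \<open>\<tau>\<close> that increases to 1 suffices, which makes the complement a countable union of null sets.\<close>
definition wild_domain :: "real \<Rightarrow> real \<Rightarrow> (real \<Rightarrow> ennreal) \<Rightarrow> real set" where
  "wild_domain \<Delta> w g = {x. \<forall>k::nat. wild_series \<Delta> w g (1 - 1 / real (k + 1)) x < \<top>}"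

definition wild_density :: "real \<Rightarrow> real \<Rightarrow> (real \<Rightarrow> ennreal) \<Rightarrow> real \<Rightarrow> real \<Rightarrow> real" where
  "wild_density \<Delta> w g x t = (if x \<in> wild_domain \<Delta> w g
     then exp (- 2 * t) * (\<Sum>n. enn2real (wild \<Delta> w g n x) * (1 - exp (- 2 * t)) ^ n) else 0)"

lemma measurable_wild_series [measurable]:
  assumes "g \<in> borel_measurable borel"
  shows "wild_series \<Delta> w g \<tau> \<in> borel_measurable borel"
proof -
  note [measurable] = measurable_wild[OF assms]
  show ?thesis unfolding wild_series_def by measurable
qed

lemma measurable_wild_domain [measurable]:
  assumes "g \<in> borel_measurable borel"
  shows "wild_domain \<Delta> w g \<in> sets borel"
proof -
  note [measurable] = measurable_wild_series[OF assms]
  show ?thesis unfolding wild_domain_def by measurable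
qed

lemma nn_integral_wild_series:
  assumes "0 < w" and g: "g \<in> borel_measurable borel" "(\<integral>\<^sup>+x. g x \<partial>lborel) = 1" and \<tau>: "0 \<le> \<tau>" "\<tau> < 1"
  shows "(\<integral>\<^sup>+x. wild_series \<Delta> w g \<tau> x \<partial>lborel) = ennreal (1 / (1 - \<tau>))"
proof -
  note [measurable] = measurable_wild[OF g(1)]
  have "(\<integral>\<^sup>+x. wild_series \<Delta> w g \<tau> x \<partial>lborel) = (\<Sum>n. ennreal (\<tau> ^ n))"
    unfolding wild_series_def
    by (simp add: nn_integral_suminf nn_integral_cmult nn_integral_wild[OF \<open>0 < w\<close> g])
  also have "\<dots> = ennreal (\<Sum>n. \<tau> ^ n)"
    using \<tau> by (intro suminf_ennreal2 summable_geometric) auto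
  also have "(\<Sum>n. \<tau> ^ n) = 1 / (1 - \<tau>)"
    using \<tau> by (intro suminf_geometric) auto
  finally show ?thesis .
qed

lemma AE_wild_domain:
  assumes "0 < w" and g: "g \<in> borel_measurable borel" "(\<integral>\<^sup>+x. g x \<partial>lborel) = 1"
  shows "AE x in lborel. x \<in> wild_domain \<Delta> w g"
proof -
  note [measurable] = measurable_wild_series[OF g(1)]
  have "AE x in lborel. wild_series \<Delta> w g (1 - 1 / real (k + 1)) x \<noteq> \<top>" for k
    using nn_integral_wild_series[OF assms, of "1 - 1 / real (k + 1)"]
    by (intro nn_integral_PInf_AE[unfolded infinity_ennreal_def]) auto
  then have "AE x in lborel. \<forall>k. wild_series \<Delta> w g (1 - 1 / real (k + 1)) x \<noteq> \<top>"
    by (simp add: AE_all_countable)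
  then show ?thesis by (simp add: wild_domain_def less_top)
qed

lemma wild_series_finite:
  assumes x: "x \<in> wild_domain \<Delta> w g" and \<tau>: "0 \<le> \<tau>" "\<tau> < 1"
  shows "wild_series \<Delta> w g \<tau> x < \<top>"
proof -
  obtain k where k: "1 / real (Suc k) < 1 - \<tau>"
    using \<tau> nat_approx_posE[of "1 - \<tau>"] by auto
  have "wild_series \<Delta> w g \<tau> x \<le> wild_series \<Delta> w g (1 - 1 / real (k + 1)) x"
    unfolding wild_series_def using \<tau> k
    by (intro suminf_le mult_right_mono ennreal_leI power_mono summableI) auto
  also have "\<dots> < \<top>" using x by (simp add: wild_domain_def)
  finally show ?thesis .
qed

lemma wild_finite:
  assumes x: "x \<in> wild_domain \<Delta> w g"
  shows "wild \<Delta> w g n x < \<top>"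
proof -
  let ?a = "\<lambda>n. ennreal ((1 / 2) ^ n) * wild \<Delta> w g n x"
  have "?a n \<le> (\<Sum>n. ?a n)"
    using sum_le_suminf[of ?a "{n}"] by (auto intro: summableI)
  also have "\<dots> < \<top>"
    using wild_series_finite[OF x, of "1 / 2"] by (simp add: wild_series_def)
  finally show ?thesis
    unfolding ennreal_mult_less_top using ennreal_less_zero_iff[of "(1 / 2) ^ n"] by force
qed

lemma wild_series_real:
  assumes x: "x \<in> wild_domain \<Delta> w g" and \<tau>: "0 \<le> \<tau>" "\<tau> < 1"
  shows "summable (\<lambda>n. enn2real (wild \<Delta> w g n x) * \<tau> ^ n)"
    "ennreal (\<Sum>n. enn2real (wild \<Delta> w g n x) * \<tau> ^ n) = wild_series \<Delta> w g \<tau> x"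
proof -
  let ?a = "\<lambda>n. enn2real (wild \<Delta> w g n x) * \<tau> ^ n"
  have a: "ennreal (?a n) = ennreal (\<tau> ^ n) * wild \<Delta> w g n x" for n
    using wild_finite[OF x, of n] \<tau> by (simp add: ennreal_mult mult.commute less_top)
  have eq: "(\<Sum>n. ennreal (?a n)) = wild_series \<Delta> w g \<tau> x"
    by (simp add: a wild_series_def)
  show "summable ?a"
    using wild_series_finite[OF x \<tau>] \<tau> eq
    by (intro summable_suminf_not_top) (auto simp: less_top)
  then show "ennreal (suminf ?a) = wild_series \<Delta> w g \<tau> x"
    using \<tau> by (subst eq[symmetric], intro suminf_ennreal2[symmetric]) auto
qed

text \<open>With \<open>\<Phi>(\<tau>) = \<Sum>\<^sub>n \<tau>^n u\<^sub>n(x)\<close> this is \<open>\<Phi>' = B(\<Phi>, \<Phi>)\<close>. The left-hand side is finite inside the radius of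
convergence, and hence so is the right-hand side: no separate argument is needed for the existence
of the gain integral.\<close>
lemma wild_series_derivative:
  assumes g: "g \<in> borel_measurable borel" and x: "x \<in> wild_domain \<Delta> w g" and \<tau>: "0 \<le> \<tau>" "\<tau> < 1"
  obtains D where "((\<lambda>\<tau>. \<Sum>n. enn2real (wild \<Delta> w g n x) * \<tau> ^ n) has_real_derivative D) (at \<tau>)"
    "0 \<le> D" "wild_product \<Delta> w (wild_series \<Delta> w g \<tau>) (wild_series \<Delta> w g \<tau>) x = ennreal D"
proof
  note [measurable] = measurable_wild[OF g(1)]
  let ?a = "\<lambda>n. enn2real (wild \<Delta> w g n x)"
  \<comment> \<open>any point strictly between \<open>\<tau>\<close> and the radius of convergence\<close>
  define K where "K = (\<tau> + 1) / 2"
  have K: "\<tau> < K" "K < 1" "0 \<le> K" using \<tau> by (auto simp: K_def)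
  have sK: "summable (\<lambda>n. ?a n * K ^ n)"
    using wild_series_real(1)[OF x] K by simp
  have d0: "0 \<le> diffs ?a n" for n by (simp add: diffs_def)
  show "((\<lambda>\<tau>. \<Sum>n. ?a n * \<tau> ^ n) has_real_derivative (\<Sum>n. diffs ?a n * \<tau> ^ n)) (at \<tau>)"
    using termdiffs_strong[OF sK, of \<tau>] K \<tau> by simp
  have sd: "summable (\<lambda>n. diffs ?a n * \<tau> ^ n)"
    using K \<tau> powser_inside[OF sK] by (intro termdiff_converges[of \<tau> K ?a]) auto
  show "0 \<le> (\<Sum>n. diffs ?a n * \<tau> ^ n)"
    using \<tau> d0 by (intro suminf_nonneg sd) auto
  \<comment> \<open>The recursion of the Wild coefficients is exactly the coefficient form of \<open>\<Phi>' = B(\<Phi>, \<Phi>)\<close>.\<close>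
  have dn: "ennreal (diffs ?a n) = (\<Sum>k\<le>n. wild_product \<Delta> w (wild \<Delta> w g k) (wild \<Delta> w g (n - k)) x)" for n
  proof -
    have "ennreal (diffs ?a n) = of_nat (Suc n) * wild \<Delta> w g (Suc n) x"
      using wild_finite[OF x, of "Suc n"] unfolding diffs_def
      by (simp add: ennreal_mult ennreal_of_nat_eq_real_of_nat less_top del: of_nat_Suc wild.simps)
    also have "\<dots> = (\<Sum>k\<le>n. wild_product \<Delta> w (wild \<Delta> w g k) (wild \<Delta> w g (n - k)) x)"
      unfolding wild.simps
      by (simp add: ennreal_times_divide mult.commute[of "of_nat (Suc n)"] ennreal_mult_divide_eq
          of_nat_less_top less_imp_neq[OF of_nat_less_top] del: of_nat_Suc)
    finally show ?thesis .
  qed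
  have "wild_product \<Delta> w (wild_series \<Delta> w g \<tau>) (wild_series \<Delta> w g \<tau>) x =
      (\<Sum>k. \<Sum>l. ennreal (\<tau> ^ k) * ennreal (\<tau> ^ l) * wild_product \<Delta> w (wild \<Delta> w g k) (wild \<Delta> w g l) x)"
    unfolding wild_series_def by (simp add: wild_product_suminf wild_product_cmult)
  also have "\<dots> = (\<Sum>n. \<Sum>k\<le>n. ennreal (\<tau> ^ k) * ennreal (\<tau> ^ (n - k)) * wild_product \<Delta> w (wild \<Delta> w g k) (wild \<Delta> w g (n - k)) x)"
    by (rule suminf_ennreal_Cauchy_product)
  also have "\<dots> = (\<Sum>n. ennreal (diffs ?a n * \<tau> ^ n))"
  proof (rule suminf_cong)
    fix n
    have "(\<Sum>k\<le>n. ennreal (\<tau> ^ k) * ennreal (\<tau> ^ (n - k)) * wild_product \<Delta> w (wild \<Delta> w g k) (wild \<Delta> w g (n - k)) x)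
      = (\<Sum>k\<le>n. ennreal (\<tau> ^ n) * wild_product \<Delta> w (wild \<Delta> w g k) (wild \<Delta> w g (n - k)) x)"
      using \<tau> by (intro sum.cong refl) (simp add: ennreal_mult[symmetric] power_add[symmetric])
    then show "(\<Sum>k\<le>n. ennreal (\<tau> ^ k) * ennreal (\<tau> ^ (n - k)) * wild_product \<Delta> w (wild \<Delta> w g k) (wild \<Delta> w g (n - k)) x)
      = ennreal (diffs ?a n * \<tau> ^ n)"
      using d0 \<tau> by (simp add: ennreal_mult dn sum_distrib_left mult.commute)
  qed
  also have "\<dots> = ennreal (\<Sum>n. diffs ?a n * \<tau> ^ n)"
    using d0 \<tau> sd by (intro suminf_ennreal2) auto
  finally show "wild_product \<Delta> w (wild_series \<Delta> w g \<tau>) (wild_series \<Delta> w g \<tau>) x = ennreal (\<Sum>n. diffs ?a n * \<tau> ^ n)" .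
qed

lemma ennreal_wild_density:
  assumes "x \<in> wild_domain \<Delta> w g" "0 \<le> t"
  shows "ennreal (wild_density \<Delta> w g x t) = ennreal (exp (- 2 * t)) * wild_series \<Delta> w g (1 - exp (- 2 * t)) x"
  using wild_series_real(2)[OF assms(1), of "1 - exp (- 2 * t)"] assms
  by (simp add: wild_density_def ennreal_mult')

text \<open>The series integrates to the geometric series \<open>1 / (1 - \<tau>) = 1 / p\<close>, which the prefactor \<open>p\<close> normalizes.\<close>
lemma prob_density01_wild_density:
  assumes w: "0 < w" "w < 1" and g: "g \<in> borel_measurable borel" "(\<integral>\<^sup>+x. g x \<partial>lborel) = 1"
    and outside: "\<And>x. x \<notin> {0..1} \<Longrightarrow> g x = 0" and t: "0 \<le> t"
  shows "prob_density01 (\<lambda>x. wild_density \<Delta> w g x t)"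
proof (rule prob_density01I)
  note [measurable] = measurable_wild[OF g(1)] measurable_wild_domain[OF g(1)] measurable_wild_series[OF g(1)]
  show "(\<lambda>x. wild_density \<Delta> w g x t) \<in> borel_measurable borel"
    unfolding wild_density_def by measurable
  show "0 \<le> wild_density \<Delta> w g x t" for x
    using wild_series_real(1)[of x \<Delta> w g "1 - exp (- 2 * t)"] t
    by (auto simp: wild_density_def intro!: mult_nonneg_nonneg suminf_nonneg)
  show "wild_density \<Delta> w g x t = 0" if "x \<notin> {0..1}" for x
    unfolding wild_density_def using wild_outside[OF w outside that] by simp
  have "(\<integral>\<^sup>+x. ennreal (wild_density \<Delta> w g x t) \<partial>lborel) =
      (\<integral>\<^sup>+x. ennreal (exp (- 2 * t)) * wild_series \<Delta> w g (1 - exp (- 2 * t)) x \<partial>lborel)"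
    using AE_wild_domain[OF w(1) g, of \<Delta>]
    by (intro nn_integral_cong_AE) (auto simp: ennreal_wild_density t)
  also have "\<dots> = ennreal (exp (- 2 * t)) * ennreal (1 / exp (- 2 * t))"
    using t nn_integral_wild_series[OF w(1) g, of "1 - exp (- 2 * t)"] by (simp add: nn_integral_cmult)
  also have "\<dots> = 1"
    by (simp add: ennreal_mult[symmetric])
  finally show "(\<integral>\<^sup>+x. ennreal (wild_density \<Delta> w g x t) \<partial>lborel) = 1" .
qed

lemma solves_ide_wild_density:
  assumes w: "0 < w" "w < 1" and g: "g \<in> borel_measurable borel" "(\<integral>\<^sup>+x. g x \<partial>lborel) = 1"
    and outside: "\<And>x. x \<notin> {0..1} \<Longrightarrow> g x = 0"
  shows "solves_ide \<Delta> w (wild_density \<Delta> w g)"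
proof -
  have "set_integrable lborel {x - \<Delta> * w .. x + \<Delta> * w}
          (\<lambda>y. wild_density \<Delta> w g ((x - (1 - w) * y) / w) t * wild_density \<Delta> w g y t) \<and>
        set_integrable lborel {x - \<Delta> .. x + \<Delta>} (\<lambda>y. wild_density \<Delta> w g y t) \<and>
        ((\<lambda>s. wild_density \<Delta> w g x s) has_real_derivative
           (2 / w * gain_integral \<Delta> w (\<lambda>y. wild_density \<Delta> w g y t) x
            - 2 * wild_density \<Delta> w g x t * near_mass \<Delta> (\<lambda>y. wild_density \<Delta> w g y t) x))
          (at t within {0..})"
    if x: "x \<in> wild_domain \<Delta> w g" and t: "0 \<le> t" for x t
  proof -
    let ?f = "\<lambda>y. wild_density \<Delta> w g y t"
    let ?\<Phi> = "\<lambda>\<tau>. \<Sum>n. enn2real (wild \<Delta> w g n x) * \<tau> ^ n"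
    define p where "p = exp (- 2 * t)"
    have p: "0 \<le> 1 - p" "1 - p < 1" using t by (auto simp: p_def)
    have f: "prob_density01 ?f"
      by (rule prob_density01_wild_density[OF w g outside t])
    obtain D where D: "(?\<Phi> has_real_derivative D) (at (1 - p))" "0 \<le> D"
      "wild_product \<Delta> w (wild_series \<Delta> w g (1 - p)) (wild_series \<Delta> w g (1 - p)) x = ennreal D"
      using wild_series_derivative[OF g(1) x p] by blast
    have "AE y in lborel. ennreal (?f y) = ennreal p * wild_series \<Delta> w g (1 - p) y"
      using AE_wild_domain[OF w(1) g, of \<Delta>]
      by eventually_elim (simp add: ennreal_wild_density t p_def)
    then have "wild_product \<Delta> w (\<lambda>y. ennreal (?f y)) (\<lambda>y. ennreal (?f y)) x =
      wild_product \<Delta> w (\<lambda>y. ennreal p * wild_series \<Delta> w g (1 - p) y) (\<lambda>y. ennreal p * wild_series \<Delta> w g (1 - p) y) x"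
      using x t by (intro wild_product_cong_AE[OF w]) (simp_all add: ennreal_wild_density p_def)
    also have "\<dots> = ennreal (p * p * D)"
      using measurable_wild_series[OF g(1)] D p
      by (simp add: wild_product_cmult p_def ennreal_mult)
    finally have wp: "wild_product \<Delta> w (\<lambda>y. ennreal (?f y)) (\<lambda>y. ennreal (?f y)) x = ennreal (p * p * D)" .
    have "0 \<le> p * p * D" using D by simp
    note R = wild_product_eq_real[OF f w(1) this wp]
    have fx: "wild_density \<Delta> w g x s = exp (- 2 * s) * ?\<Phi> (1 - exp (- 2 * s))" for s
      using x by (simp add: wild_density_def)
    \<comment> \<open>The chain rule for \<open>p \<Phi>(1 - p)\<close>, where \<open>p' = - 2 p\<close>.\<close>
    have "((\<lambda>s. exp (- 2 * s) * ?\<Phi> (1 - exp (- 2 * s))) has_real_derivative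
        (- 2 * p * ?\<Phi> (1 - p) + p * (D * (2 * p)))) (at t)"
    proof -
      have "((\<lambda>s. 1 - exp (- 2 * s)) has_real_derivative 2 * p) (at t)"
        unfolding p_def by (auto intro!: derivative_eq_intros)
      then have "((\<lambda>s. ?\<Phi> (1 - exp (- 2 * s))) has_real_derivative D * (2 * p)) (at t)"
        using D(1) unfolding p_def by (intro DERIV_chain2[of ?\<Phi>]) auto
      moreover have "((\<lambda>s. exp (- 2 * s)) has_real_derivative - 2 * p) (at t)"
        unfolding p_def by (auto intro!: derivative_eq_intros)
      ultimately show ?thesis
        using DERIV_mult[of "\<lambda>s. exp (- 2 * s)" "- 2 * p" t UNIV "\<lambda>s. ?\<Phi> (1 - exp (- 2 * s))" "D * (2 * p)"]
        by (simp add: p_def mult_ac)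
    qed
    moreover have "- 2 * p * ?\<Phi> (1 - p) + p * (D * (2 * p)) =
      2 / w * gain_integral \<Delta> w ?f x - 2 * ?f x * near_mass \<Delta> ?f x"
    proof -
      have "- 2 * p * ?\<Phi> (1 - p) + p * (D * (2 * p)) = - 2 * ?f x + 2 * (p * p * D)"
        using fx[of t] by (simp add: p_def)
      then show ?thesis unfolding R(2) by (simp add: algebra_simps)
    qed
    ultimately have "((\<lambda>s. wild_density \<Delta> w g x s) has_real_derivative
       2 / w * gain_integral \<Delta> w ?f x - 2 * ?f x * near_mass \<Delta> ?f x) (at t within {0..})"
      unfolding fx by (simp only: has_field_derivative_at_within)
    then show ?thesis
      using R(1) set_integrable_prob_density01[OF f] by simp
  qed
  then show ?thesis
    using AE_wild_domain[OF w(1) g, of \<Delta>] 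
    unfolding solves_ide_def gain_integral_def near_mass_def
    by (auto elim!: eventually_mono)
qed

theorem ide_solution_exists:
  assumes w: "0 < w" "w < 1" and g: "prob_density01 g"
  obtains f where "\<And>t. 0 \<le> t \<Longrightarrow> prob_density01 (\<lambda>x. f x t)" "solves_ide \<Delta> w f"
    "AE x in lborel. f x 0 = g x"
proof
  let ?g = "\<lambda>x. ennreal (g x)"
  note g' = prob_density01_simps[OF g]
  have *: "?g \<in> borel_measurable borel" "(\<integral>\<^sup>+x. ?g x \<partial>lborel) = 1" "\<And>x. x \<notin> {0..1} \<Longrightarrow> ?g x = 0"
    using g' by auto
  show "prob_density01 (\<lambda>x. wild_density \<Delta> w ?g x t)" if "0 \<le> t" for t
    by (rule prob_density01_wild_density[OF w * that])
  show "solves_ide \<Delta> w (wild_density \<Delta> w ?g)"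
    by (rule solves_ide_wild_density[OF w *])
  show "AE x in lborel. wild_density \<Delta> w ?g x 0 = g x"
    using AE_wild_domain[OF w(1) *(1,2), of \<Delta>]
    by eventually_elim (simp add: wild_density_def powser_zero g'(2))
qed

section \<open>Problem 1 and the integro-differential equation\<close>

theorem theorem6p1:
  fixes \<Delta> w :: real
  assumes "0 < \<Delta>" "\<Delta> \<le> 1" "0 < w" "w < 1"
  shows "(\<forall>m0 m. solves_problem1 \<Delta> w m0 m \<and> absolutely_continuous lborel01 m0 \<longrightarrow>
            (\<forall>t\<ge>0. absolutely_continuous lborel01 (m t)) \<and>
            (\<exists>f :: real \<Rightarrow> real \<Rightarrow> real.
               (\<forall>t\<ge>0. prob_density01 (\<lambda>x. f x t) \<and> m t = measure01_of (\<lambda>x. f x t)) \<and>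
               solves_ide \<Delta> w f)) \<and>
         (\<forall>f :: real \<Rightarrow> real \<Rightarrow> real.
            solves_ide \<Delta> w f \<and> (\<forall>t\<ge>0. prob_density01 (\<lambda>x. f x t)) \<longrightarrow>
            solves_problem1 \<Delta> w (measure01_of (\<lambda>x. f x 0)) (\<lambda>t. measure01_of (\<lambda>x. f x t)))"
proof -
  note w = \<open>0 < w\<close> \<open>w < 1\<close>
  have forward: "\<exists>f. (\<forall>t\<ge>0. prob_density01 (\<lambda>x. f x t) \<and> m t = measure01_of (\<lambda>x. f x t)) \<and> solves_ide \<Delta> w f"
    if m: "solves_problem1 \<Delta> w m0 m" and ac: "absolutely_continuous lborel01 m0" for m0 m
  proof -
    have "m0 \<in> prob_measures01" using m by (auto simp: solves_problem1_def)
    then obtain g where g: "prob_density01 g" "m0 = measure01_of g"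
      using density_of_absolutely_continuous ac by blast
    obtain f where f: "\<And>t. 0 \<le> t \<Longrightarrow> prob_density01 (\<lambda>x. f x t)" "solves_ide \<Delta> w f"
      "AE x in lborel. f x 0 = g x"
      using ide_solution_exists[OF w g(1)] by blast
    have "measure01_of (\<lambda>x. f x 0) = m0"
      unfolding g(2) using f(3) prob_density01_simps(1)[OF f(1)[of 0]] prob_density01_simps(1)[OF g(1)]
      by (intro measure01_of_cong_AE) auto
    then have "solves_problem1 \<Delta> w m0 (\<lambda>t. measure01_of (\<lambda>x. f x t))"
      using ide_solution_solves_problem1[OF w f(2,1)] by simp
    then have "m t = measure01_of (\<lambda>x. f x t)" if "0 \<le> t" for t
      using problem1_unique[OF w m _ that] by blast
    then show ?thesis using f by blast
  qed
  have "absolutely_continuous lborel01 (m t)"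
    if "solves_problem1 \<Delta> w m0 m" "absolutely_continuous lborel01 m0" "0 \<le> t" for m0 m t
    using forward[OF that(1,2)] that(3) prob_density01_simps(1) absolutely_continuous_measure01_of by metis
  then show ?thesis
    using forward ide_solution_solves_problem1[OF w] by blast
qed

end
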